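(* Let $k$ be a positive integer. There is a single finite straightedge-and-compass construction that, from every pair of positive input segments $a,b$, produces a segment $c$ satisfying $$\frac1{c^k}=\frac1{a^k}+\frac1{b^k},\qquad\text{equivalently}\qquad c=\frac{ab}{(a^k+b^k)^{1/k}},$$ if and only if $k=2^m$ for some nonnegative integer $m$.
   Context: Letters $a,b,c$ denote both segments in the Euclidean plane and their (positive real) lengths. "Straightedge and compass" has its classical meaning: the straightedge is unmarked, and the only permitted intersections are those of lines and circles already constructed. Explicitly, one starts from the endpoints of a segment of length $a$ and of a segment of length $b$; the permitted operations are drawing the line through two distinct already constructed points, drawing the circle centred at an already constructed point with radius the distance between two already constructed points, and adjoining intersection points of lines and circles already drawn. A segment is produced when its two endpoints are constructed points. A "single finite construction" is one fixed finite procedure (a fixed finite list of such operations, including the rule prescribing which intersection point is taken at each step, for instance the one on a given ray or on a given side of a given line) that does not depend on $a,b$ and is valid for every pair of positive lengths $a,b$; constructibility of $c$ for some particular pairs only is not what is meant. No unit segment is given besides the two input segments. *)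

theory Defs
  imports "HOL-Analysis.Analysis"
begin

text \<open>
  The Euclidean plane is the type \<^typ>\<open>complex\<close> with its usual distance. No point of it is
  distinguished: a construction may refer only to points it has been given or has constructed.
\<close>

type_synonym point = complex

definition ray :: "point \<Rightarrow> point \<Rightarrow> point set" where
  "ray P Q = {P + t *\<^sub>R (Q - P) | t. 0 \<le> t}"

text \<open>The cross product of the vectors from \<open>P\<close> to \<open>Q\<close> and from \<open>P\<close> to \<open>X\<close> is positive.\<close>

definition left_of :: "point \<Rightarrow> point \<Rightarrow> point \<Rightarrow> bool" where
  "left_of P Q X \<longleftrightarrow>
     0 < Re (Q - P) * Im (X - P) - Im (Q - P) * Re (X - P)"

definition same_side :: "point \<Rightarrow> point \<Rightarrow> point \<Rightarrow> point \<Rightarrow> bool" where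
  "same_side P Q X Y \<longleftrightarrow> P \<noteq> Q \<and> closed_segment X Y \<inter> affine hull {P, Q} = {}"

text \<open>
  Rules prescribing which intersection point is taken. They are Boolean combinations of elementary
  geometric relations between points. A rule that selects without orientation would not suffice:
  when all points constructed so far are collinear, the two candidates may be mirror images of each
  other in that line, and only a relation such as \<open>Left_Of\<close> tells them apart.
\<close>

datatype (refs: 'p) rule =
    Unrestricted
  | Same_Point 'p 'p
  | On_Ray 'p 'p 'p
  | Left_Of 'p 'p 'p
  | Same_Side 'p 'p 'p 'p
  | Closer 'p 'p 'p 'p
  | Neg "'p rule"
  | Conj "'p rule" "'p rule"

primrec holds :: "('p \<Rightarrow> point) \<Rightarrow> 'p rule \<Rightarrow> bool" where
  "holds v Unrestricted \<longleftrightarrow> True"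
| "holds v (Same_Point p q) \<longleftrightarrow> v p = v q"
| "holds v (On_Ray p q x) \<longleftrightarrow> v x \<in> ray (v p) (v q)"
| "holds v (Left_Of p q x) \<longleftrightarrow> left_of (v p) (v q) (v x)"
| "holds v (Same_Side p q x y) \<longleftrightarrow> same_side (v p) (v q) (v x) (v y)"
| "holds v (Closer p q r s) \<longleftrightarrow> dist (v p) (v q) < dist (v r) (v s)"
| "holds v (Neg r) \<longleftrightarrow> \<not> holds v r"
| "holds v (Conj r s) \<longleftrightarrow> holds v r \<and> holds v s"

text \<open>
  A state consists of the points constructed and of the lines and circles drawn so far, each in
  order of creation; steps refer to them by their positions in these two lists.
\<close>

type_synonym state = "point list \<times> point set list"

datatype step =
    Draw_Line nat nat
  | Draw_Circle nat nat nat
  | Intersect nat nat "nat rule"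

text \<open>
  The point \<open>X\<close> is a candidate for the intersection step. Inside the rule it is referred to by the
  position \<^term>\<open>length ps\<close> which it will occupy once adjoined.
\<close>

definition selected :: "state \<Rightarrow> nat \<Rightarrow> nat \<Rightarrow> nat rule \<Rightarrow> point \<Rightarrow> bool" where
  "selected = (\<lambda>(ps, cs) u v r X. X \<in> cs ! u \<inter> cs ! v \<and> holds (\<lambda>i. (ps @ [X]) ! i) r)"

text \<open>
  The result \<^term>\<open>None\<close> means that the step cannot be carried out: an index is out of range, the
  two points meant to determine a line or a radius coincide, the two curves to be intersected are
  the same, or the rule does not single out exactly one of their common points.
\<close>

fun exec :: "step \<Rightarrow> state \<Rightarrow> state option" where
  "exec (Draw_Line i j) (ps, cs) =
     (if i < length ps \<and> j < length ps \<and> ps ! i \<noteq> ps ! j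
      then Some (ps, cs @ [affine hull {ps ! i, ps ! j}]) else None)"
| "exec (Draw_Circle i j k) (ps, cs) =
     (if i < length ps \<and> j < length ps \<and> k < length ps \<and> ps ! j \<noteq> ps ! k
      then Some (ps, cs @ [sphere (ps ! i) (dist (ps ! j) (ps ! k))]) else None)"
| "exec (Intersect u v r) (ps, cs) =
     (if u < length cs \<and> v < length cs \<and> cs ! u \<noteq> cs ! v \<and> refs r \<subseteq> {..length ps}
         \<and> (\<exists>!X. selected (ps, cs) u v r X)
      then Some (ps @ [THE X. selected (ps, cs) u v r X], cs) else None)"

primrec run :: "step list \<Rightarrow> state \<Rightarrow> state option" where
  "run [] s = Some s"
| "run (x # xs) s = Option.bind (exec x s) (run xs)"

text \<open>
  Run on the endpoints of segments \<open>AB\<close> and \<open>CD\<close>, the construction \<open>xs\<close> can be carried out in full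
  and its points number \<open>i\<close> and \<open>j\<close> are the endpoints of a segment of length \<open>c\<close>.
\<close>

definition produces ::
    "step list \<Rightarrow> nat \<Rightarrow> nat \<Rightarrow> point \<Rightarrow> point \<Rightarrow> point \<Rightarrow> point \<Rightarrow> real \<Rightarrow> bool" where
  "produces xs i j A B C D c \<longleftrightarrow>
     (\<exists>ps cs. run xs ([A, B, C, D], []) = Some (ps, cs)
        \<and> i < length ps \<and> j < length ps \<and> ps ! i \<noteq> ps ! j \<and> c = dist (ps ! i) (ps ! j))"

end

theory Submission
  imports Defs
begin

text \<open>
  If \<open>k\<close> is not a power of two, no construction can succeed even for two unit segments with
  rational end points. All points constructed from them have coordinates that arise from rational
  numbers by field operations and square roots, since intersecting lines and circles amounts to
  solving linear and quadratic equations (\<open>euclidean_state_run\<close>). A length \<open>c\<close> with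
  \<open>c ^ k = 1 / 2\<close> would yield, after repeated squaring, a \<open>q\<close>-th root of \<open>1 / 2\<close> among these
  numbers, where \<open>q\<close> is the odd part of \<open>k\<close>. Such numbers lie in a tower of real quadratic
  extensions of the rationals. In a step of the tower, conjugation turns a root of odd order of an
  element of the smaller field into another real root of the same order; but there is only one, so
  it is fixed by conjugation and lies in the smaller field already (\<open>odd_root_descends\<close>). Thus the
  root would be rational, which is possible for \<open>q = 1\<close> only.

  Conversely, let \<open>k = 2 ^ m\<close>. Constructions commute with similarities (\<open>run_similarity\<close>), so one may
  place the first segment between \<open>0\<close> and \<open>1\<close> and use it as unit. Perpendicular bisectors and the
  altitude theorem in right triangles then give sums, squares, reciprocals and square roots of
  lengths. With \<open>t\<close> the second length, they suffice for the reciprocal of the \<open>k\<close>-th root of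
  \<open>1 + (1 / t) ^ k\<close>, because a root of order \<open>2 ^ m\<close> is an iterated square root
  (\<open>constructible_power_sum_root\<close>).

  The steps of a construction refer to points by position. To combine constructions without
  renumbering, a point is called constructible if every program valid for all inputs can be
  prolonged to one that also produces this point (\<open>attainable\<close>). Every use of an intersection
  step passes through \<open>constructible_intersection\<close>, which hides the positions.
\<close>

section \<open>Real quadratic towers and odd roots\<close>

text \<open>
  The closure contains the rational numbers, so it is the field of all real numbers that are
  constructible from a unit segment.
\<close>

inductive_set euclidean_number :: "real set" where
  one: "1 \<in> euclidean_number"
| diff: "a \<in> euclidean_number \<Longrightarrow> b \<in> euclidean_number \<Longrightarrow> a - b \<in> euclidean_number"
| mult: "a \<in> euclidean_number \<Longrightarrow> b \<in> euclidean_number \<Longrightarrow> a * b \<in> euclidean_number"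
| inverse: "a \<in> euclidean_number \<Longrightarrow> inverse a \<in> euclidean_number"
| sqrt: "a \<in> euclidean_number \<Longrightarrow> 0 \<le> a \<Longrightarrow> sqrt a \<in> euclidean_number"

text \<open>
  Subfields of the reals are kept as plain sets, because the tower below adjoins square roots to
  them one after another.
\<close>

definition real_subfield :: "real set \<Rightarrow> bool" where
  "real_subfield F \<longleftrightarrow> 1 \<in> F \<and> (\<forall>a\<in>F. \<forall>b\<in>F. a - b \<in> F) \<and> (\<forall>a\<in>F. \<forall>b\<in>F. a * b \<in> F)
     \<and> (\<forall>a\<in>F. inverse a \<in> F)"

lemma real_subfieldD:
  assumes "real_subfield F"
  shows "1 \<in> F" "0 \<in> F" "a \<in> F \<Longrightarrow> b \<in> F \<Longrightarrow> a - b \<in> F" "a \<in> F \<Longrightarrow> b \<in> F \<Longrightarrow> a * b \<in> F"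
    "a \<in> F \<Longrightarrow> inverse a \<in> F" "a \<in> F \<Longrightarrow> - a \<in> F" "a \<in> F \<Longrightarrow> b \<in> F \<Longrightarrow> a + b \<in> F"
    "a \<in> F \<Longrightarrow> b \<in> F \<Longrightarrow> a / b \<in> F" "numeral n \<in> F" "a \<in> F \<Longrightarrow> a ^ e \<in> F"
proof -
  show one: "1 \<in> F" and diff: "\<And>a b. a \<in> F \<Longrightarrow> b \<in> F \<Longrightarrow> a - b \<in> F"
    and mult: "\<And>a b. a \<in> F \<Longrightarrow> b \<in> F \<Longrightarrow> a * b \<in> F" and inv: "\<And>a. a \<in> F \<Longrightarrow> inverse a \<in> F"
    using assms by (auto simp: real_subfield_def)
  show zero: "0 \<in> F"
    using diff[OF one one] by simp
  show neg: "\<And>a. a \<in> F \<Longrightarrow> - a \<in> F"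
    using diff[OF zero] by simp
  show add: "\<And>a b. a \<in> F \<Longrightarrow> b \<in> F \<Longrightarrow> a + b \<in> F"
    using diff neg by (metis diff_minus_eq_add)
  show "\<And>a b. a \<in> F \<Longrightarrow> b \<in> F \<Longrightarrow> a / b \<in> F"
    using mult inv by (simp add: divide_inverse)
  have "of_nat m \<in> F" for m
    by (induction m) (use zero one add in auto)
  then show "numeral n \<in> F"
    by (metis of_nat_numeral)
  show "a \<in> F \<Longrightarrow> a ^ e \<in> F"
    by (induction e) (use one mult in auto)
qed

lemma real_subfield_euclidean_number: "real_subfield euclidean_number"
  by (auto simp: real_subfield_def intro: euclidean_number.intros)

lemma real_subfield_Rats: "real_subfield \<rat>"
  by (auto simp: real_subfield_def)

definition adjoin_sqrt :: "real set \<Rightarrow> real \<Rightarrow> real set" where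
  "adjoin_sqrt F d = {u + v * sqrt d | u v. u \<in> F \<and> v \<in> F}"

lemma adjoin_sqrtI: "u \<in> F \<Longrightarrow> v \<in> F \<Longrightarrow> x = u + v * sqrt d \<Longrightarrow> x \<in> adjoin_sqrt F d"
  by (auto simp: adjoin_sqrt_def)

text \<open>
  Requiring \<^term>\<open>sqrt d \<notin> F\<close> makes every step a proper extension, so that the
  representation \<open>u + v * sqrt d\<close> is unique and conjugation is well defined.
\<close>

inductive quadratic_tower :: "real set \<Rightarrow> bool" where
  base: "quadratic_tower \<rat>"
| step: "quadratic_tower F \<Longrightarrow> d \<in> F \<Longrightarrow> 0 \<le> d \<Longrightarrow> sqrt d \<notin> F \<Longrightarrow> quadratic_tower (adjoin_sqrt F d)"

text \<open>
  This makes the representation of an element as \<open>u + v * sqrt d\<close> unique.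
\<close>

lemma sqrt_independent:
  assumes "real_subfield F" "sqrt d \<notin> F" "u \<in> F" "v \<in> F" "v * sqrt d = u"
  shows "v = 0"
proof (rule ccontr)
  assume "v \<noteq> 0"
  then have "sqrt d = u / v"
    using assms(5) by (simp add: field_simps)
  then show False
    using assms real_subfieldD(8) by metis
qed

text \<open>
  The inverse of \<open>u + v * sqrt d\<close> is found by multiplying numerator and denominator by the
  conjugate \<open>u - v * sqrt d\<close>, which cannot vanish because \<open>sqrt d\<close> lies outside \<open>F\<close>.
\<close>

lemma real_subfield_adjoin_sqrt:
  assumes F: "real_subfield F" and d: "d \<in> F" "0 \<le> d" "sqrt d \<notin> F"
  shows "real_subfield (adjoin_sqrt F d)"
proof -
  note [intro] = real_subfieldD[OF F]
  have s: "sqrt d * sqrt d = d"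
    using d by simp
  have product: "(u * w + v * x * d) + (u * x + v * w) * sqrt d = (u + v * sqrt d) * (w + x * sqrt d)"
    for u v w x
  proof -
    have "(u + v * sqrt d) * (w + x * sqrt d)
        = u * w + v * x * (sqrt d * sqrt d) + (u * x + v * w) * sqrt d"
      by (simp only: algebra_simps)
    then show ?thesis
      by (simp only: s)
  qed
  have inv: "\<exists>w\<in>F. \<exists>x\<in>F. inverse (u + v * sqrt d) = w + x * sqrt d" if uv: "u \<in> F" "v \<in> F" for u v
  proof (cases "u + v * sqrt d = 0")
    case True
    then show ?thesis
      using real_subfieldD(2)[OF F] by (intro bexI[of _ 0]) auto
  next
    case False
    have "u - v * sqrt d \<noteq> 0"
    proof
      assume *: "u - v * sqrt d = 0"
      then have "v = 0"
        using sqrt_independent[OF F d(3) uv] by simp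
      then show False
        using * False by simp
    qed
    moreover have "(u + v * sqrt d) * (u - v * sqrt d) = u * u - v * v * d"
    proof -
      have "(u + v * sqrt d) * (u - v * sqrt d) = u * u - v * v * (sqrt d * sqrt d)"
        by (simp only: algebra_simps)
      then show ?thesis
        by (simp only: s)
    qed
    ultimately have "inverse (u + v * sqrt d) = (u - v * sqrt d) / (u * u - v * v * d)"
      using False by (metis inverse_eq_divide nonzero_divide_mult_cancel_right)
    also have "\<dots> = u / (u * u - v * v * d) + (- v / (u * u - v * v * d)) * sqrt d"
      by (simp add: diff_divide_distrib)
    finally show ?thesis
      using uv d by blast
  qed
  show ?thesis
    unfolding real_subfield_def
  proof (intro conjI ballI)
    show "1 \<in> adjoin_sqrt F d"
      by (rule adjoin_sqrtI[of 1 _ 0]) (use real_subfieldD(1,2)[OF F] in auto)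
  next
    fix a b assume "a \<in> adjoin_sqrt F d" "b \<in> adjoin_sqrt F d"
    then obtain u v w x where uv: "u \<in> F" "v \<in> F" "a = u + v * sqrt d"
      and wx: "w \<in> F" "x \<in> F" "b = w + x * sqrt d"
      by (auto simp: adjoin_sqrt_def)
    show "a - b \<in> adjoin_sqrt F d"
      by (rule adjoin_sqrtI[of "u - w" _ "v - x"])
        (use uv wx real_subfieldD(3)[OF F] in \<open>auto simp: algebra_simps\<close>)
    show "a * b \<in> adjoin_sqrt F d"
      unfolding uv(3) wx(3)
      by (rule adjoin_sqrtI[OF _ _ product[symmetric]])
        (use uv wx d(1) real_subfieldD(4,7)[OF F] in auto)
  next
    fix a assume "a \<in> adjoin_sqrt F d"
    then show "inverse a \<in> adjoin_sqrt F d"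
      using inv unfolding adjoin_sqrt_def by blast
  qed
qed

lemma quadratic_tower_subfield: "quadratic_tower F \<Longrightarrow> real_subfield F"
  by (induction rule: quadratic_tower.induct)
    (auto intro: real_subfield_Rats real_subfield_adjoin_sqrt)

text \<open>
  Starting from an arbitrary tower \<open>F\<close> is what makes the induction work: the operands of a binary
  operation are reached one after the other, the second one in a tower above the first.
\<close>

lemma euclidean_number_in_tower:
  assumes "x \<in> euclidean_number" "quadratic_tower F"
  shows "\<exists>G. quadratic_tower G \<and> F \<subseteq> G \<and> x \<in> G"
  using assms
proof (induction arbitrary: F)
  case one
  then show ?case
    using quadratic_tower_subfield real_subfieldD(1) by blast
next
  case (diff a b)
  then show ?case
    by (meson quadratic_tower_subfield real_subfieldD(3) subset_iff)
next
  case (mult a b)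
  then show ?case
    by (meson quadratic_tower_subfield real_subfieldD(4) subset_iff)
next
  case (inverse a)
  then show ?case
    by (meson quadratic_tower_subfield real_subfieldD(5))
next
  case (sqrt a)
  then obtain G where G: "quadratic_tower G" "F \<subseteq> G" "a \<in> G"
    by blast
  show ?case
  proof (cases "sqrt a \<in> G")
    case True
    then show ?thesis using G by blast
  next
    case False
    note sub = real_subfieldD[OF quadratic_tower_subfield[OF G(1)]]
    have "G \<subseteq> adjoin_sqrt G a" "sqrt a \<in> adjoin_sqrt G a"
      using sub(1,2) by (auto intro: adjoin_sqrtI[of _ _ 0] adjoin_sqrtI[of 0 _ 1])
    then show ?thesis
      using quadratic_tower.step[OF G(1,3) sqrt.hyps(2) False] G(2) by blast
  qed
qed

text \<open>
  Powers of conjugate elements stay conjugate.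
\<close>

lemma adjoin_sqrt_power:
  assumes F: "real_subfield F" and d: "d \<in> F" "0 \<le> d" and uv: "u \<in> F" "v \<in> F"
  shows "\<exists>w\<in>F. \<exists>x\<in>F. (u + v * sqrt d) ^ n = w + x * sqrt d \<and> (u - v * sqrt d) ^ n = w - x * sqrt d"
proof (induction n)
  case 0
  show ?case
    using real_subfieldD(1,2)[OF F] by (intro bexI[of _ 1] bexI[of _ 0]) auto
next
  case (Suc n)
  note [intro] = real_subfieldD[OF F]
  from Suc obtain w x where wx: "w \<in> F" "x \<in> F"
    and eq: "(u + v * sqrt d) ^ n = w + x * sqrt d" "(u - v * sqrt d) ^ n = w - x * sqrt d"
    by blast
  have s: "sqrt d * sqrt d = d"
    using d by simp
  have "(u + v * sqrt d) ^ Suc n = u * w + v * x * (sqrt d * sqrt d) + (u * x + v * w) * sqrt d"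
    "(u - v * sqrt d) ^ Suc n = u * w + v * x * (sqrt d * sqrt d) - (u * x + v * w) * sqrt d"
    by (simp_all only: power_Suc eq algebra_simps)
  then show ?case
    unfolding s using wx uv d by blast
qed

text \<open>
  If \<open>y = u + v * sqrt d\<close> has its \<open>n\<close>-th power in \<open>F\<close>, then its conjugate has the same
  \<open>n\<close>-th power. Both are real and \<open>n\<close> is odd, so they coincide and \<open>v * sqrt d\<close> vanishes. This
  uniqueness of real odd roots takes the place of an argument with degrees of field extensions.
\<close>

lemma odd_root_descends:
  assumes F: "real_subfield F" and d: "d \<in> F" "0 \<le> d" "sqrt d \<notin> F"
    and y: "y \<in> adjoin_sqrt F d" and n: "odd n" and yn: "y ^ n \<in> F"
  shows "y \<in> F"
proof -
  obtain u v where uv: "u \<in> F" "v \<in> F" and y_eq: "y = u + v * sqrt d"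
    using y by (auto simp: adjoin_sqrt_def)
  obtain w x where wx: "w \<in> F" "x \<in> F"
    and eq: "y ^ n = w + x * sqrt d" "(u - v * sqrt d) ^ n = w - x * sqrt d"
    using adjoin_sqrt_power[OF F d(1,2) uv] y_eq by blast
  have "x * sqrt d = y ^ n - w"
    using eq(1) by simp
  moreover have "y ^ n - w \<in> F"
    using yn wx(1) by (rule real_subfieldD(3)[OF F])
  ultimately have "x = 0"
    using sqrt_independent[OF F d(3) _ wx(2)] by blast
  then have "(u - v * sqrt d) ^ n = y ^ n"
    using eq by simp
  then have "u - v * sqrt d = y"
    using odd_real_root_power_cancel[OF n] by metis
  then have "y = u"
    unfolding y_eq by simp
  then show ?thesis
    using uv(1) by simp
qed

lemma odd_root_in_tower_rational:
  assumes "quadratic_tower F" "y \<in> F" "odd n" "y ^ n \<in> \<rat>"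
  shows "y \<in> \<rat>"
  using assms
proof (induction arbitrary: y)
  case base
  then show ?case by simp
next
  case (step F d)
  have "\<rat> \<subseteq> F"
    using step.hyps(1)
  proof (induction rule: quadratic_tower.induct)
    case (step F d)
    have "x \<in> adjoin_sqrt F d" if "x \<in> F" for x
      by (rule adjoin_sqrtI[of x _ 0])
        (use that real_subfieldD(2)[OF quadratic_tower_subfield[OF step.hyps(1)]] in auto)
    then show ?case
      using step.IH by blast
  qed simp
  then show ?case
    using odd_root_descends[OF quadratic_tower_subfield[OF step.hyps(1)] step.hyps(2-4)] step by blast
qed

text \<open>
  Write the root as \<open>p / q\<close> and compare the exponents of 2 in \<open>2 * p ^ n = q ^ n\<close>.
\<close>

lemma rational_root_half:
  assumes "y \<in> \<rat>" "y ^ n = (1 / 2 :: real)"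
  shows "n = 1"
proof -
  obtain p q :: int where pq: "q \<noteq> 0" "y = of_int p / of_int q"
    using assms(1) by (metis Rats_cases' less_irrefl)
  have "2 * (of_int p :: real) ^ n = of_int q ^ n"
    using assms(2) pq by (simp add: power_divide field_simps)
  then have "real_of_int (2 * p ^ n) = real_of_int (q ^ n)"
    by simp
  then have eq: "2 * p ^ n = q ^ n"
    using of_int_eq_iff by blast
  have n0: "n \<noteq> 0"
    using assms(2) by (intro notI) simp
  have p0: "p \<noteq> 0"
    using eq pq(1) n0 by (intro notI) (simp add: power_0_left)
  have pr: "prime_elem (2::int)"
    by simp
  \<comment> \<open>\<open>n\<close> divides the right-hand exponent of 2 below, and the left-hand one is 1 modulo \<open>n\<close>.\<close>
  have "multiplicity 2 (2 * p ^ n) = Suc (n * multiplicity 2 p)"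
    using p0 pr by (simp add: multiplicity_times_same prime_elem_multiplicity_power_distrib)
  moreover have "multiplicity 2 (q ^ n) = n * multiplicity 2 q"
    using pq(1) pr by (simp add: prime_elem_multiplicity_power_distrib)
  ultimately have "Suc (n * multiplicity 2 p) = n * multiplicity 2 q"
    using eq by simp
  then have "n dvd Suc (n * multiplicity 2 p)"
    by simp
  then show ?thesis
    using dvd_add_right_iff[of n "n * multiplicity 2 p" 1] by simp
qed

text \<open>
  Write \<open>k = 2 ^ e * q\<close> with \<open>q\<close> odd. Then \<open>c ^ 2 ^ e\<close> is a Euclidean number and a \<open>q\<close>-th root of
  \<open>1 / 2\<close>; by the descent it is rational, which leaves only \<open>q = 1\<close>.
\<close>

lemma euclidean_root_half_power_of_two:
  assumes "c \<in> euclidean_number" "c ^ k = 1 / 2"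
  shows "\<exists>m. k = 2 ^ m"
proof -
  have "k \<noteq> 0"
    using assms(2) by (intro notI) simp
  then obtain q where q: "k = 2 ^ multiplicity 2 k * q" "odd q"
    using multiplicity_decompose'[of k 2] by auto
  let ?y = "c ^ (2 ^ multiplicity 2 k)"
  have yq: "?y ^ q = 1 / 2"
    using assms(2) q(1) by (metis power_mult)
  have "?y \<in> euclidean_number"
    using real_subfieldD(10)[OF real_subfield_euclidean_number assms(1)] .
  then obtain F where "quadratic_tower F" "?y \<in> F"
    using euclidean_number_in_tower quadratic_tower.base by blast
  then have "?y \<in> \<rat>"
    using odd_root_in_tower_rational q(2) yq by (metis Rats_1 Rats_divide Rats_number_of)
  then have "q = 1"
    using rational_root_half yq by blast
  then show ?thesis
    using q(1) by auto
qed

section \<open>Coordinates of constructed points\<close>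

lemma line_equation:
  assumes "P \<noteq> Q"
  shows "affine hull {P, Q} = {z. Re (Q - P) * Im (z - P) = Im (Q - P) * Re (z - P)}"
proof -
  have "z \<in> affine hull {P, Q}" if *: "Re (Q - P) * Im (z - P) = Im (Q - P) * Re (z - P)" for z
  proof -
    define n where "n = Re (Q - P) * Re (Q - P) + Im (Q - P) * Im (Q - P)"
    define t where "t = (Re (Q - P) * Re (z - P) + Im (Q - P) * Im (z - P)) / n"
    have "n \<noteq> 0"
      using assms unfolding n_def by (auto simp: sum_squares_eq_zero_iff complex_eq_iff)
    then have "z = (1 - t) *\<^sub>R P + t *\<^sub>R Q"
      using * unfolding complex_eq_iff t_def
      \<comment> \<open>Clearing the denominator \<open>n\<close> before unfolding it leaves two polynomial identities.\<close>
      apply (simp add: field_simps)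
      unfolding n_def
      apply (simp add: algebra_simps)
      apply algebra
      done
    then show ?thesis
      unfolding affine_hull_2 by (auto intro: exI[of _ "1 - t"])
  qed
  moreover have "Re (Q - P) * Im (z - P) = Im (Q - P) * Re (z - P)" if z: "z \<in> affine hull {P, Q}" for z
  proof -
    obtain u v where uv: "z = u *\<^sub>R P + v *\<^sub>R Q" "u + v = 1"
      using z unfolding affine_hull_2 by auto
    have "u = 1 - v"
      using uv(2) by simp
    then have "z = P + v *\<^sub>R (Q - P)"
      unfolding uv(1) by (simp add: scaleR_diff_left scaleR_diff_right)
    then show ?thesis
      by simp
  qed
  ultimately show ?thesis
    by blast
qed

definition euclidean_point :: "point \<Rightarrow> bool" where
  "euclidean_point z \<longleftrightarrow> Re z \<in> euclidean_number \<and> Im z \<in> euclidean_number"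

text \<open>
  Lines and circles are described by equations with Euclidean coefficients. The equation of a circle
  may also describe a point or the empty set; these loci satisfy the same intersection lemmas.
\<close>

definition euclidean_line :: "point set \<Rightarrow> bool" where
  "euclidean_line S \<longleftrightarrow> (\<exists>p\<in>euclidean_number. \<exists>q\<in>euclidean_number. \<exists>r\<in>euclidean_number.
     (p \<noteq> 0 \<or> q \<noteq> 0) \<and> S = {z. p * Re z + q * Im z = r})"

definition euclidean_circle :: "point set \<Rightarrow> bool" where
  "euclidean_circle S \<longleftrightarrow> (\<exists>p\<in>euclidean_number. \<exists>q\<in>euclidean_number. \<exists>r\<in>euclidean_number.
     S = {z. (Re z)\<^sup>2 + (Im z)\<^sup>2 + p * Re z + q * Im z = r})"

lemmas euclidean_closure = real_subfieldD[OF real_subfield_euclidean_number]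

text \<open>
  Complete the square: \<open>2 * \<alpha> * t + \<beta>\<close> is a square root of the discriminant, up to sign.
\<close>

lemma quadratic_root_euclidean:
  assumes "\<alpha> \<in> euclidean_number" "\<beta> \<in> euclidean_number" "\<gamma> \<in> euclidean_number" "\<alpha> \<noteq> 0"
    and "\<alpha> * t\<^sup>2 + \<beta> * t + \<gamma> = 0"
  shows "t \<in> euclidean_number"
proof -
  let ?D = "\<beta>\<^sup>2 - 4 * \<alpha> * \<gamma>"
  have sq: "(2 * \<alpha> * t + \<beta>)\<^sup>2 = ?D"
    using assms(5) by algebra
  then have "0 \<le> ?D"
    by (metis zero_le_power2)
  moreover have "?D \<in> euclidean_number"
    using assms(1-3) by (intro euclidean_closure)
  ultimately have "sqrt ?D \<in> euclidean_number"
    by (rule euclidean_number.sqrt[rotated])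
  then have "\<bar>2 * \<alpha> * t + \<beta>\<bar> \<in> euclidean_number"
    using sq real_sqrt_abs by metis
  then have "2 * \<alpha> * t + \<beta> \<in> euclidean_number"
    using euclidean_closure(6) by (metis abs_if minus_minus)
  then have "(2 * \<alpha> * t + \<beta> - \<beta>) / (2 * \<alpha>) \<in> euclidean_number"
    by (rule euclidean_closure(8)[OF euclidean_closure(3)])
      (intro euclidean_closure assms(1,2))+
  also have "(2 * \<alpha> * t + \<beta> - \<beta>) / (2 * \<alpha>) = t"
    using assms(4) by simp
  finally show ?thesis .
qed

text \<open>
  Cramer's rule; the determinant vanishes only if the two lines, having a common point, are equal.
\<close>

lemma line_line_euclidean:
  assumes "euclidean_line S" "euclidean_line T" "S \<noteq> T" "z \<in> S" "z \<in> T"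
  shows "euclidean_point z"
proof -
  obtain p q r where pqr: "p \<in> euclidean_number" "q \<in> euclidean_number" "r \<in> euclidean_number"
    "p \<noteq> 0 \<or> q \<noteq> 0" "S = {z. p * Re z + q * Im z = r}"
    using assms(1) by (auto simp: euclidean_line_def)
  obtain p' q' r' where pqr': "p' \<in> euclidean_number" "q' \<in> euclidean_number" "r' \<in> euclidean_number"
    "p' \<noteq> 0 \<or> q' \<noteq> 0" "T = {z. p' * Re z + q' * Im z = r'}"
    using assms(2) by (auto simp: euclidean_line_def)
  have e: "p * Re z + q * Im z = r" "p' * Re z + q' * Im z = r'"
    using assms(4,5) pqr pqr' by auto
  let ?D = "p * q' - p' * q"
  have "?D \<noteq> 0"
  proof
    assume D: "?D = 0"
    \<comment> \<open>The normal vectors are proportional, hence so are the equations, as both hold at \<open>z\<close>.\<close>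
    obtain l where l: "p' = l * p" "q' = l * q"
    proof (cases "p = 0")
      case True
      then show ?thesis
        using D pqr(4) that[of "q' / q"] by auto
    next
      case False
      then show ?thesis
        using D that[of "p' / p"] by (auto simp: field_simps)
    qed
    then have "l \<noteq> 0" "r' = l * r"
      using pqr'(4) e by (auto simp: algebra_simps)
    moreover have "p' * x + q' * y = l * (p * x + q * y)" for x y
      using l by (simp add: algebra_simps)
    ultimately have "S = T"
      using pqr(5) pqr'(5) by simp
    then show False
      using assms(3) by simp
  qed
  moreover have "?D * Re z = r * q' - r' * q"
    by (simp add: algebra_simps flip: e)
  moreover have "?D * Im z = p * r' - p' * r"
    by (simp add: algebra_simps flip: e)
  ultimately have "Re z = (r * q' - r' * q) / ?D" "Im z = (p * r' - p' * r) / ?D"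
    by (simp_all add: field_simps)
  then show ?thesis
    using pqr pqr' by (auto simp only: euclidean_point_def intro!: euclidean_closure)
qed

text \<open>
  On a line with normal vector \<open>(p, q)\<close> every point is the foot of the perpendicular from the origin
  plus a multiple \<open>t\<close> of \<open>(- q, p)\<close>. Substituting this into the equation of the circle gives a
  quadratic equation for \<open>t\<close>.
\<close>

lemma line_circle_euclidean:
  assumes "euclidean_line S" "euclidean_circle T" "z \<in> S" "z \<in> T"
  shows "euclidean_point z"
proof -
  obtain p q r where pqr: "p \<in> euclidean_number" "q \<in> euclidean_number" "r \<in> euclidean_number"
    "p \<noteq> 0 \<or> q \<noteq> 0" "S = {z. p * Re z + q * Im z = r}"
    using assms(1) by (auto simp: euclidean_line_def)
  obtain p' q' r' where pqr': "p' \<in> euclidean_number" "q' \<in> euclidean_number" "r' \<in> euclidean_number"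
    "T = {z. (Re z)\<^sup>2 + (Im z)\<^sup>2 + p' * Re z + q' * Im z = r'}"
    using assms(2) by (auto simp: euclidean_circle_def)
  have e: "p * Re z + q * Im z = r" "(Re z)\<^sup>2 + (Im z)\<^sup>2 + p' * Re z + q' * Im z = r'"
    using assms(3,4) pqr pqr' by auto
  define n where "n = p\<^sup>2 + q\<^sup>2"
  define t where "t = (p * Im z - q * Re z) / n"
  have n: "n \<noteq> 0" "n \<in> euclidean_number"
    using pqr unfolding n_def by (auto simp: sum_power2_eq_zero_iff intro!: euclidean_closure)
  then have tn: "t * n = p * Im z - q * Re z"
    by (simp add: t_def)
  have "n * Re z = r * p - t * n * q"
    unfolding tn by (simp add: n_def power2_eq_square algebra_simps flip: e(1))
  moreover have "n * Im z = r * q + t * n * p"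
    unfolding tn by (simp add: n_def power2_eq_square algebra_simps flip: e(1))
  ultimately have xy: "Re z = r * p / n - t * q" "Im z = r * q / n + t * p"
    using n(1) by (simp_all add: field_simps)
  have "n * t\<^sup>2 + (q' * p - p' * q) * t + (r\<^sup>2 / n + (p' * p + q' * q) * r / n - r') = 0"
  proof -
    have "(r * p / n - t * q)\<^sup>2 + (r * q / n + t * p)\<^sup>2 = (r / n)\<^sup>2 * n + n * t\<^sup>2"
      unfolding n_def by (simp add: power2_eq_square algebra_simps add_divide_distrib diff_divide_distrib)
    moreover have "(r / n)\<^sup>2 * n = r\<^sup>2 / n"
      using n(1) by (simp add: power2_eq_square)
    ultimately show ?thesis
      using e(2) unfolding xy by (simp add: algebra_simps add_divide_distrib)
  qed
  then have "t \<in> euclidean_number"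
    by (rule quadratic_root_euclidean[rotated 4]) (use n pqr pqr' in \<open>auto intro!: euclidean_closure\<close>)
  then show ?thesis
    using n(2) pqr pqr' unfolding euclidean_point_def xy by (auto intro!: euclidean_closure)
qed

text \<open>
  The difference of the two equations is the equation of the radical axis, which reduces the claim to
  the intersection of a line and a circle.
\<close>

lemma circle_circle_euclidean:
  assumes "euclidean_circle S" "euclidean_circle T" "S \<noteq> T" "z \<in> S" "z \<in> T"
  shows "euclidean_point z"
proof -
  obtain p q r where pqr: "p \<in> euclidean_number" "q \<in> euclidean_number" "r \<in> euclidean_number"
    "S = {z. (Re z)\<^sup>2 + (Im z)\<^sup>2 + p * Re z + q * Im z = r}"
    using assms(1) by (auto simp: euclidean_circle_def)
  obtain p' q' r' where pqr': "p' \<in> euclidean_number" "q' \<in> euclidean_number" "r' \<in> euclidean_number"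
    "T = {z. (Re z)\<^sup>2 + (Im z)\<^sup>2 + p' * Re z + q' * Im z = r'}"
    using assms(2) by (auto simp: euclidean_circle_def)
  have e: "(Re z)\<^sup>2 + (Im z)\<^sup>2 + p * Re z + q * Im z = r"
    "(Re z)\<^sup>2 + (Im z)\<^sup>2 + p' * Re z + q' * Im z = r'"
    using assms(4,5) pqr pqr' by auto
  have "p - p' \<noteq> 0 \<or> q - q' \<noteq> 0"
    using e assms(3) pqr(4) pqr'(4) by auto
  then have "euclidean_line {z. (p - p') * Re z + (q - q') * Im z = r - r'}"
    using pqr pqr' unfolding euclidean_line_def by (blast intro: euclidean_closure)
  then show ?thesis
    by (rule line_circle_euclidean[OF _ assms(1) _ assms(4)]) (use e in \<open>simp add: algebra_simps\<close>)
qed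

lemma euclidean_line_hull:
  assumes "euclidean_point P" "euclidean_point Q" "P \<noteq> Q"
  shows "euclidean_line (affine hull {P, Q})"
proof -
  let ?p = "- Im (Q - P)" and ?q = "Re (Q - P)"
  let ?r = "Re (Q - P) * Im P - Im (Q - P) * Re P"
  have "affine hull {P, Q} = {z. ?p * Re z + ?q * Im z = ?r}"
    unfolding line_equation[OF assms(3)] by (auto simp: algebra_simps)
  moreover have "?p \<noteq> 0 \<or> ?q \<noteq> 0"
    using assms(3) by (auto simp: complex_eq_iff)
  moreover have "?p \<in> euclidean_number" "?q \<in> euclidean_number" "?r \<in> euclidean_number"
    using assms(1,2) by (auto simp: euclidean_point_def intro!: euclidean_closure)
  ultimately show ?thesis
    unfolding euclidean_line_def by blast
qed

lemma dist_euclidean: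
  assumes "euclidean_point P" "euclidean_point Q"
  shows "dist P Q \<in> euclidean_number"
proof -
  have "(Re P - Re Q)\<^sup>2 + (Im P - Im Q)\<^sup>2 \<in> euclidean_number"
    using assms unfolding euclidean_point_def by (intro euclidean_closure) auto
  then show ?thesis
    unfolding dist_complex_def cmod_def minus_complex.simps
    by (rule euclidean_number.sqrt) simp
qed

lemma euclidean_circle_sphere:
  assumes "euclidean_point P" "R \<in> euclidean_number" "0 \<le> R"
  shows "euclidean_circle (sphere P R)"
proof -
  \<comment> \<open>Expand the squared distance from \<open>P\<close>.\<close>
  let ?p = "- 2 * Re P" and ?q = "- 2 * Im P" and ?r = "R\<^sup>2 - (Re P)\<^sup>2 - (Im P)\<^sup>2"
  have "dist P z = R \<longleftrightarrow> (Re z)\<^sup>2 + (Im z)\<^sup>2 + ?p * Re z + ?q * Im z = ?r" for z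
  proof -
    have "dist P z = R \<longleftrightarrow> (dist P z)\<^sup>2 = R\<^sup>2"
      using assms(3) by (simp add: power2_eq_iff_nonneg)
    also have "(dist P z)\<^sup>2 = (Re P - Re z)\<^sup>2 + (Im P - Im z)\<^sup>2"
      by (simp add: dist_complex_def cmod_power2)
    finally show ?thesis
      by (simp add: power2_eq_square algebra_simps)
  qed
  then have S: "sphere P R = {z. (Re z)\<^sup>2 + (Im z)\<^sup>2 + ?p * Re z + ?q * Im z = ?r}"
    by (auto simp: sphere_def)
  have "?p \<in> euclidean_number" "?q \<in> euclidean_number" "?r \<in> euclidean_number"
    using assms unfolding euclidean_point_def by (intro euclidean_closure; simp)+
  then show ?thesis
    unfolding euclidean_circle_def using S by blast
qed

definition euclidean_state :: "state \<Rightarrow> bool" where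
  "euclidean_state s \<longleftrightarrow> (\<forall>z\<in>set (fst s). euclidean_point z)
     \<and> (\<forall>S\<in>set (snd s). euclidean_line S \<or> euclidean_circle S)"

text \<open>
  Whichever point the rule of an intersection step selects, it is a common point of two distinct
  Euclidean curves.
\<close>

lemma euclidean_state_exec:
  assumes "euclidean_state s" "exec x s = Some s'"
  shows "euclidean_state s'"
proof -
  obtain ps cs where s: "s = (ps, cs)"
    by force
  show ?thesis
  proof (cases x)
    case (Draw_Line i j)
    then show ?thesis
      using assms unfolding s by (auto simp: euclidean_state_def euclidean_line_hull split: if_splits)
  next
    case (Draw_Circle i j k)
    then show ?thesis
      using assms unfolding s
      by (auto simp: euclidean_state_def euclidean_circle_sphere dist_euclidean split: if_splits)
  next
    case (Intersect u v r)
    define X where "X = (THE X. selected (ps, cs) u v r X)"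
    have *: "u < length cs" "v < length cs" "cs ! u \<noteq> cs ! v" "\<exists>!X. selected (ps, cs) u v r X"
      "s' = (ps @ [X], cs)"
      using assms(2) unfolding s Intersect X_def by (auto split: if_splits)
    have "X \<in> cs ! u" "X \<in> cs ! v"
      using theI'[OF *(4)] by (simp_all add: X_def selected_def)
    moreover have "euclidean_line S \<or> euclidean_circle S" if "S \<in> set cs" for S
      using assms(1) that by (auto simp: euclidean_state_def s)
    ultimately have "euclidean_point X"
      using *(1-3) line_line_euclidean line_circle_euclidean circle_circle_euclidean nth_mem by metis
    then show ?thesis
      using assms(1) *(5) by (auto simp: euclidean_state_def s)
  qed
qed

lemma euclidean_state_run:
  "euclidean_state s \<Longrightarrow> run xs s = Some s' \<Longrightarrow> euclidean_state s'"
  by (induction xs arbitrary: s) (auto split: bind_splits intro: euclidean_state_exec)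

text \<open>
  A single pair of inputs suffices, two unit segments with rational end points: the length produced
  from them satisfies \<open>c ^ k = 1 / 2\<close>.
\<close>

lemma power_of_two_if_constructible:
  assumes "\<forall>A B C D. A \<noteq> B \<longrightarrow> C \<noteq> D \<longrightarrow>
    (\<exists>c. produces xs i j A B C D c \<and> 1 / c ^ k = 1 / dist A B ^ k + 1 / dist C D ^ k)"
  shows "\<exists>m. k = 2 ^ m"
proof -
  obtain c where c: "produces xs i j 0 1 0 1 c" "1 / c ^ k = 1 / dist (0::complex) 1 ^ k + 1 / dist (0::complex) 1 ^ k"
    using assms zero_neq_one by metis
  obtain ps cs where ps: "run xs ([0, 1, 0, 1], []) = Some (ps, cs)" "i < length ps" "j < length ps"
    "c = dist (ps ! i) (ps ! j)"
    using c(1) by (auto simp: produces_def)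
  have "euclidean_state ([0, 1, 0, 1], [])"
    by (auto simp: euclidean_state_def euclidean_point_def euclidean_closure)
  then have "euclidean_state (ps, cs)"
    using ps(1) by (rule euclidean_state_run)
  then have "c \<in> euclidean_number"
    using ps by (simp add: euclidean_state_def dist_euclidean)
  moreover have "c ^ k = inverse (1 / c ^ k)"
    by simp
  then have "c ^ k = 1 / 2"
    using c(2) by simp
  ultimately show ?thesis
    by (rule euclidean_root_half_power_of_two)
qed


section \<open>Invariance of constructions under similarities\<close>

text \<open>
  The orientation-preserving similarities of the plane, for \<open>q \<noteq> 0\<close>. Mirror images are left out
  on purpose, since the rule \<^const>\<open>Left_Of\<close> can tell them apart.
\<close>

definition similarity :: "complex \<Rightarrow> complex \<Rightarrow> point \<Rightarrow> point" where
  "similarity p q z = p + q * z"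

lemma inj_similarity: "q \<noteq> 0 \<Longrightarrow> inj (similarity p q)"
  by (auto simp: inj_def similarity_def)

lemma surj_similarity: "q \<noteq> 0 \<Longrightarrow> surj (similarity p q)"
  by (rule surjI[of _ "\<lambda>z. (z - p) / q"]) (simp add: similarity_def)

lemma similarity_eq_iff: "q \<noteq> 0 \<Longrightarrow> similarity p q x = similarity p q y \<longleftrightarrow> x = y"
  by (simp add: similarity_def)

lemma similarity_affine: "similarity p q (P + t *\<^sub>R (Q - P))
   = similarity p q P + t *\<^sub>R (similarity p q Q - similarity p q P)"
  by (simp add: similarity_def scaleR_conv_of_real algebra_simps)

lemma dist_similarity: "dist (similarity p q x) (similarity p q y) = cmod q * dist x y"
  by (simp add: similarity_def dist_norm norm_mult flip: right_diff_distrib)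

lemma ray_similarity: "ray (similarity p q P) (similarity p q Q) = similarity p q ` ray P Q"
  unfolding ray_def similarity_affine[symmetric] by blast

lemma similarity_comp: "similarity p q ` S = (\<lambda>z. p + z) ` (\<lambda>z. q * z) ` S"
  by (simp add: image_image similarity_def)

lemma segment_similarity:
  "closed_segment (similarity p q X) (similarity p q Y) = similarity p q ` closed_segment X Y"
  unfolding similarity_comp closed_segment_translation
  by (simp add: similarity_def closed_segment_translation
      closed_segment_linear_image[OF bounded_linear.linear[OF bounded_linear_mult_right]])

lemma hull_similarity:
  "affine hull {similarity p q P, similarity p q Q} = similarity p q ` (affine hull {P, Q})"
proof -
  have "affine hull ((\<lambda>z. q * z) ` {P, Q}) = (\<lambda>z. q * z) ` (affine hull {P, Q})"
    using affine_hull_linear_image[OF bounded_linear_mult_right] by metis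
  moreover have "{similarity p q P, similarity p q Q} = (\<lambda>z. p + z) ` (\<lambda>z. q * z) ` {P, Q}"
    by (simp add: similarity_def)
  ultimately show ?thesis
    unfolding similarity_comp by (simp only: affine_hull_translation)
qed

lemma sphere_similarity:
  assumes "q \<noteq> 0"
  shows "sphere (similarity p q P) (cmod q * R) = similarity p q ` sphere P R"
proof -
  have "similarity p q x \<in> similarity p q ` sphere P R \<longleftrightarrow> similarity p q x \<in> sphere (similarity p q P) (cmod q * R)" for x
    using assms by (auto simp: inj_image_mem_iff[OF inj_similarity] dist_similarity)
  then show ?thesis
    using surjD[OF surj_similarity[OF assms]] by (metis subsetI subset_antisym)
qed

lemma left_of_similarity:
  assumes "q \<noteq> 0"
  shows "left_of (similarity p q P) (similarity p q Q) (similarity p q X) \<longleftrightarrow> left_of P Q X"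
proof -
  have cross: "Re (q * u) * Im (q * v) - Im (q * u) * Re (q * v)
      = (cmod q)\<^sup>2 * (Re u * Im v - Im u * Re v)" for u v
    by (simp add: cmod_power2) algebra
  have "similarity p q x - similarity p q y = q * (x - y)" for x y
    by (simp add: similarity_def algebra_simps)
  then show ?thesis
    unfolding left_of_def using assms by (simp only: cross zero_less_mult_iff) auto
qed

lemma holds_similarity:
  assumes "q \<noteq> 0"
  shows "holds (\<lambda>i. similarity p q (v i)) r \<longleftrightarrow> holds v r"
proof (induction r)
  case (Same_Side a b x y)
  show ?case
    using assms by (simp add: same_side_def segment_similarity hull_similarity similarity_eq_iff
        flip: image_Int[OF inj_similarity])
qed (use assms in \<open>auto simp: similarity_eq_iff ray_similarity inj_image_mem_iff[OF inj_similarity]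
    left_of_similarity dist_similarity\<close>)

definition map_state :: "(point \<Rightarrow> point) \<Rightarrow> state \<Rightarrow> state" where
  "map_state f s = (map f (fst s), map ((`) f) (snd s))"

lemma holds_cong: "(\<And>i. i \<in> refs r \<Longrightarrow> v i = w i) \<Longrightarrow> holds v r \<longleftrightarrow> holds w r"
  by (induction r) auto

lemma selected_similarity:
  assumes "q \<noteq> 0" "u < length cs" "v < length cs" "refs r \<subseteq> {..length ps}"
  shows "selected (map_state (similarity p q) (ps, cs)) u v r (similarity p q X)
    \<longleftrightarrow> selected (ps, cs) u v r X"
proof -
  have "holds (\<lambda>i. (map (similarity p q) ps @ [similarity p q X]) ! i) r
      \<longleftrightarrow> holds (\<lambda>i. similarity p q ((ps @ [X]) ! i)) r"
  proof (rule holds_cong)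
    fix i assume "i \<in> refs r"
    then have "i < length (ps @ [X])"
      using assms(4) by auto
    then show "(map (similarity p q) ps @ [similarity p q X]) ! i = similarity p q ((ps @ [X]) ! i)"
      by (metis list.simps(8,9) map_append nth_map)
  qed
  then show ?thesis
    using assms by (simp add: selected_def map_state_def inj_image_mem_iff[OF inj_similarity] holds_similarity)
qed

lemma exec_similarity:
  assumes "q \<noteq> 0" "exec x s = Some s'"
  shows "exec x (map_state (similarity p q) s) = Some (map_state (similarity p q) s')"
proof -
  obtain ps cs where s: "s = (ps, cs)"
    by force
  show ?thesis
  proof (cases x)
    case (Draw_Line i j)
    then show ?thesis
      using assms unfolding s
      by (auto simp: map_state_def similarity_eq_iff hull_similarity split: if_splits)
  next
    case (Draw_Circle i j k)
    then show ?thesis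
      using assms unfolding s
      by (auto simp: map_state_def similarity_eq_iff dist_similarity sphere_similarity split: if_splits)
  next
    case (Intersect u v r)
    let ?sel = "selected (ps, cs) u v r"
    let ?sel' = "selected (map (similarity p q) ps, map ((`) (similarity p q)) cs) u v r"
    define X where "X = (THE X. ?sel X)"
    have *: "u < length cs" "v < length cs" "cs ! u \<noteq> cs ! v" "refs r \<subseteq> {..length ps}" "\<exists>!X. ?sel X"
      "s' = (ps @ [X], cs)"
      using assms(2) unfolding s Intersect X_def by (auto split: if_splits)
    have sel: "?sel' (similarity p q Y) \<longleftrightarrow> ?sel Y" for Y
      using selected_similarity[OF assms(1) *(1,2,4)] by (simp add: map_state_def)
    have "?sel X"
      using theI'[OF *(5)] by (simp add: X_def)
    then have "?sel' Y \<longleftrightarrow> Y = similarity p q X" for Y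
      using sel *(5) surjD[OF surj_similarity[OF assms(1)], of Y] by metis
    then have "\<exists>!Y. ?sel' Y" "(THE Y. ?sel' Y) = similarity p q X"
      by auto
    moreover have "similarity p q ` (cs ! u) \<noteq> similarity p q ` (cs ! v)"
      using *(3) by (simp add: inj_image_eq_iff[OF inj_similarity[OF assms(1)]])
    ultimately show ?thesis
      using * unfolding s Intersect by (simp add: map_state_def)
  qed
qed

text \<open>
  The same construction, run on similar data, yields similar results. It is therefore enough to
  design constructions for data with \<open>A = 0\<close> and \<open>B = 1\<close>.
\<close>

lemma run_similarity:
  assumes "q \<noteq> 0"
  shows "run xs s = Some s' \<Longrightarrow> run xs (map_state (similarity p q) s) = Some (map_state (similarity p q) s')"
proof (induction xs arbitrary: s)
  case (Cons x xs)
  then obtain t where "exec x s = Some t" "run xs t = Some s'"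
    by (auto split: bind_splits)
  then show ?case
    using exec_similarity[OF assms] Cons.IH by simp
qed simp

section \<open>Composition of constructions\<close>

lemma run_append: "run (xs @ ys) s = Option.bind (run xs s) (run ys)"
  by (induction xs arbitrary: s) (auto split: bind_splits)

lemma exec_extends:
  assumes "exec x s = Some s'"
  shows "\<exists>us vs. s' = (fst s @ us, snd s @ vs) \<and> length us = (case x of Intersect _ _ _ \<Rightarrow> 1 | _ \<Rightarrow> 0)
    \<and> length vs = (case x of Intersect _ _ _ \<Rightarrow> 0 | _ \<Rightarrow> 1)"
  using assms by (cases s; cases x) (auto split: if_splits)

definition intersections :: "step list \<Rightarrow> nat" where
  "intersections xs = (\<Sum>x\<leftarrow>xs. case x of Intersect _ _ _ \<Rightarrow> 1 | _ \<Rightarrow> 0)"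

definition drawings :: "step list \<Rightarrow> nat" where
  "drawings xs = (\<Sum>x\<leftarrow>xs. case x of Intersect _ _ _ \<Rightarrow> 0 | _ \<Rightarrow> 1)"

text \<open>
  How many points and curves are added depends on the program only and not on the input. Hence the
  position of a point in the list is the same for all inputs, as the numbering of steps demands.
\<close>

lemma run_extends:
  "run xs s = Some s' \<Longrightarrow> \<exists>us vs. s' = (fst s @ us, snd s @ vs) \<and> length us = intersections xs
    \<and> length vs = drawings xs"
proof (induction xs arbitrary: s)
  case Nil
  then show ?case
    by (simp add: intersections_def drawings_def)
next
  case (Cons x xs)
  then obtain t where t: "exec x s = Some t" "run xs t = Some s'"
    by (auto split: bind_splits)
  show ?case
    using exec_extends[OF t(1)] Cons.IH[OF t(2)] by (fastforce simp: intersections_def drawings_def)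
qed

text \<open>
  A family of inputs of common length, each of them a list of given points. Points and curves that
  depend on the input are represented as functions of it.
\<close>

locale construction_problem =
  fixes inputs :: "point list set" and n :: nat
  assumes length_input: "\<omega> \<in> inputs \<Longrightarrow> length \<omega> = n"
begin

definition valid :: "step list \<Rightarrow> bool" where
  "valid xs \<longleftrightarrow> (\<forall>\<omega>\<in>inputs. run xs (\<omega>, []) \<noteq> None)"

definition final :: "step list \<Rightarrow> point list \<Rightarrow> state" where
  "final xs \<omega> = the (run xs (\<omega>, []))"

definition has_point :: "step list \<Rightarrow> (point list \<Rightarrow> point) \<Rightarrow> bool" where
  "has_point xs P \<longleftrightarrow> (\<exists>i < n + intersections xs. \<forall>\<omega>\<in>inputs. fst (final xs \<omega>) ! i = P \<omega>)"

definition has_curve :: "step list \<Rightarrow> (point list \<Rightarrow> point set) \<Rightarrow> bool" where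
  "has_curve xs S \<longleftrightarrow> (\<exists>i < drawings xs. \<forall>\<omega>\<in>inputs. snd (final xs \<omega>) ! i = S \<omega>)"

text \<open>
  A goal is attainable if every program that runs on all inputs can be prolonged so as to reach it.
  Quantifying over the program that precedes makes constructions composable: the second one is
  appended to the first, without any renumbering of the steps of either.
\<close>

definition attainable :: "(step list \<Rightarrow> bool) \<Rightarrow> bool" where
  "attainable G \<longleftrightarrow> (\<forall>xs. valid xs \<longrightarrow> (\<exists>ys. valid (xs @ ys) \<and> G (xs @ ys)))"

definition constructible :: "(point list \<Rightarrow> point) \<Rightarrow> bool" where
  "constructible P \<longleftrightarrow> attainable (\<lambda>xs. has_point xs P)"

definition drawable :: "(point list \<Rightarrow> point set) \<Rightarrow> bool" where
  "drawable S \<longleftrightarrow> attainable (\<lambda>xs. has_curve xs S)"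

definition persistent :: "(step list \<Rightarrow> bool) \<Rightarrow> bool" where
  "persistent G \<longleftrightarrow> (\<forall>xs ys. valid (xs @ ys) \<longrightarrow> G xs \<longrightarrow> G (xs @ ys))"

lemma length_final:
  assumes "valid xs" "\<omega> \<in> inputs"
  shows "length (fst (final xs \<omega>)) = n + intersections xs" "length (snd (final xs \<omega>)) = drawings xs"
proof -
  obtain s where s: "run xs (\<omega>, []) = Some s"
    using assms by (auto simp: valid_def)
  then show "length (fst (final xs \<omega>)) = n + intersections xs" "length (snd (final xs \<omega>)) = drawings xs"
    using run_extends[OF s] length_input[OF assms(2)] by (auto simp: final_def)
qed

lemma valid_appendD: "valid (xs @ ys) \<Longrightarrow> valid xs"
  unfolding valid_def run_append by (metis Option.bind.bind_lzero)

lemma final_append: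
  assumes "valid (xs @ ys)" "\<omega> \<in> inputs"
  shows "\<exists>us vs. final (xs @ ys) \<omega> = (fst (final xs \<omega>) @ us, snd (final xs \<omega>) @ vs)"
proof -
  obtain s where "run xs (\<omega>, []) = Some s" "final xs \<omega> = s"
    using valid_appendD[OF assms(1)] assms(2) by (auto simp: valid_def final_def)
  moreover obtain s' where "run (xs @ ys) (\<omega>, []) = Some s'" "final (xs @ ys) \<omega> = s'"
    using assms by (auto simp: valid_def final_def)
  ultimately show ?thesis
    using run_extends[of ys s s'] by (auto simp: run_append)
qed

lemma intersections_append: "intersections (xs @ ys) = intersections xs + intersections ys"
  and drawings_append: "drawings (xs @ ys) = drawings xs + drawings ys"
  by (simp_all add: intersections_def drawings_def)

lemma persistent_has_point: "persistent (\<lambda>xs. has_point xs P)"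
  unfolding persistent_def
proof (intro allI impI)
  fix xs ys assume v: "valid (xs @ ys)" and "has_point xs P"
  then obtain i where i: "i < n + intersections xs" "\<And>\<omega>. \<omega> \<in> inputs \<Longrightarrow> fst (final xs \<omega>) ! i = P \<omega>"
    by (auto simp: has_point_def)
  have "fst (final (xs @ ys) \<omega>) ! i = P \<omega>" if "\<omega> \<in> inputs" for \<omega>
    using final_append[OF v that] i length_final[OF valid_appendD[OF v] that] that
    by (auto simp: nth_append)
  then show "has_point (xs @ ys) P"
    unfolding has_point_def intersections_append using i(1) by (intro exI[of _ i]) auto
qed

lemma persistent_has_curve: "persistent (\<lambda>xs. has_curve xs S)"
  unfolding persistent_def
proof (intro allI impI)
  fix xs ys assume v: "valid (xs @ ys)" and "has_curve xs S"
  then obtain i where i: "i < drawings xs" "\<And>\<omega>. \<omega> \<in> inputs \<Longrightarrow> snd (final xs \<omega>) ! i = S \<omega>"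
    by (auto simp: has_curve_def)
  have "snd (final (xs @ ys) \<omega>) ! i = S \<omega>" if "\<omega> \<in> inputs" for \<omega>
    using final_append[OF v that] i length_final[OF valid_appendD[OF v] that] that
    by (auto simp: nth_append)
  then show "has_curve (xs @ ys) S"
    unfolding has_curve_def drawings_append using i(1) by (intro exI[of _ i]) auto
qed

lemma attainable_conj:
  assumes "attainable G" "persistent G" "attainable H"
  shows "attainable (\<lambda>xs. G xs \<and> H xs)"
  using assms unfolding attainable_def persistent_def by (metis append.assoc)

lemma attainable_Ball:
  assumes "finite A" "\<And>a. a \<in> A \<Longrightarrow> attainable (G a)" "\<And>a. a \<in> A \<Longrightarrow> persistent (G a)"
  shows "attainable (\<lambda>xs. \<forall>a\<in>A. G a xs)"
  using assms
proof (induction A rule: finite_induct)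
  case empty
  then show ?case
    unfolding attainable_def by (metis append_Nil2 empty_iff)
next
  case (insert a A)
  then have "attainable (\<lambda>xs. G a xs \<and> (\<forall>a\<in>A. G a xs))"
    by (intro attainable_conj) auto
  then show ?case
    by simp
qed

lemma attainable_step:
  assumes "attainable G" "\<And>xs. valid xs \<Longrightarrow> G xs \<Longrightarrow> \<exists>ys. valid (xs @ ys) \<and> H (xs @ ys)"
  shows "attainable H"
  using assms unfolding attainable_def by (metis append.assoc)

lemma run_snoc:
  assumes "valid xs" "\<And>\<omega>. \<omega> \<in> inputs \<Longrightarrow> exec x (final xs \<omega>) = Some (f \<omega>)"
  shows "valid (xs @ [x])" "\<And>\<omega>. \<omega> \<in> inputs \<Longrightarrow> final (xs @ [x]) \<omega> = f \<omega>"
proof -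
  have *: "run (xs @ [x]) (\<omega>, []) = Some (f \<omega>)" if "\<omega> \<in> inputs" for \<omega>
  proof -
    have "run xs (\<omega>, []) = Some (final xs \<omega>)"
      using assms(1) that by (auto simp: valid_def final_def)
    then show ?thesis
      using assms(2)[OF that] by (simp add: run_append)
  qed
  show "valid (xs @ [x])" "\<And>\<omega>. \<omega> \<in> inputs \<Longrightarrow> final (xs @ [x]) \<omega> = f \<omega>"
    using * by (auto simp: valid_def final_def)
qed

lemma constructible_input: "i < n \<Longrightarrow> constructible (\<lambda>\<omega>. \<omega> ! i)"
  unfolding constructible_def attainable_def
proof (intro allI impI exI[of _ "[]"])
  fix xs assume i: "i < n" and v: "valid xs"
  have "fst (final xs \<omega>) ! i = \<omega> ! i" if "\<omega> \<in> inputs" for \<omega>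
    using final_append[of "[]" xs, OF _ that] v i length_input[OF that]
    by (auto simp: nth_append final_def)
  then show "valid (xs @ []) \<and> has_point (xs @ []) (\<lambda>\<omega>. \<omega> ! i)"
    using v i by (auto simp: has_point_def intro!: exI[of _ i])
qed

lemma constructible_cong: "constructible P \<Longrightarrow> (\<And>\<omega>. \<omega> \<in> inputs \<Longrightarrow> P \<omega> = Q \<omega>) \<Longrightarrow> constructible Q"
  by (simp add: constructible_def has_point_def)

lemma drawable_cong: "drawable S \<Longrightarrow> (\<And>\<omega>. \<omega> \<in> inputs \<Longrightarrow> S \<omega> = T \<omega>) \<Longrightarrow> drawable T"
  by (simp add: drawable_def has_curve_def)

lemma has_new_curve:
  assumes "valid xs" "\<And>\<omega>. \<omega> \<in> inputs \<Longrightarrow> exec x (final xs \<omega>) = Some (fst (final xs \<omega>), snd (final xs \<omega>) @ [S \<omega>])"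
    and "drawings [x] = 1"
  shows "valid (xs @ [x]) \<and> has_curve (xs @ [x]) S"
proof -
  note fin = run_snoc[OF assms(1), of x "\<lambda>\<omega>. (fst (final xs \<omega>), snd (final xs \<omega>) @ [S \<omega>])", OF assms(2)]
  have "snd (final (xs @ [x]) \<omega>) ! drawings xs = S \<omega>" if "\<omega> \<in> inputs" for \<omega>
    using fin(2)[OF _ that] length_final(2)[OF assms(1) that] by (simp add: nth_append)
  then have "has_curve (xs @ [x]) S"
    unfolding has_curve_def drawings_append using assms(3) by (intro exI[of _ "drawings xs"]) simp
  then show ?thesis
    using fin(1) by blast
qed

lemma drawable_line:
  assumes "constructible P" "constructible Q" "\<And>\<omega>. \<omega> \<in> inputs \<Longrightarrow> P \<omega> \<noteq> Q \<omega>"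
  shows "drawable (\<lambda>\<omega>. affine hull {P \<omega>, Q \<omega>})"
  unfolding drawable_def
proof (rule attainable_step)
  show "attainable (\<lambda>xs. has_point xs P \<and> has_point xs Q)"
    using assms(1,2) attainable_conj persistent_has_point by (simp add: constructible_def)
next
  fix xs assume v: "valid xs" and "has_point xs P \<and> has_point xs Q"
  then obtain i j where i: "i < n + intersections xs" "\<And>\<omega>. \<omega> \<in> inputs \<Longrightarrow> fst (final xs \<omega>) ! i = P \<omega>"
    and j: "j < n + intersections xs" "\<And>\<omega>. \<omega> \<in> inputs \<Longrightarrow> fst (final xs \<omega>) ! j = Q \<omega>"
    unfolding has_point_def by blast
  have "exec (Draw_Line i j) (final xs \<omega>)
      = Some (fst (final xs \<omega>), snd (final xs \<omega>) @ [affine hull {P \<omega>, Q \<omega>}])" if "\<omega> \<in> inputs" for \<omega>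
    using i j length_final[OF v that] that assms(3)[OF that] by (cases "final xs \<omega>") force
  then show "\<exists>ys. valid (xs @ ys) \<and> has_curve (xs @ ys) (\<lambda>\<omega>. affine hull {P \<omega>, Q \<omega>})"
    using has_new_curve[OF v] by (intro exI[of _ "[Draw_Line i j]"]) (simp add: drawings_def)
qed

lemma drawable_circle:
  assumes "constructible P" "constructible Q" "constructible R" "\<And>\<omega>. \<omega> \<in> inputs \<Longrightarrow> Q \<omega> \<noteq> R \<omega>"
  shows "drawable (\<lambda>\<omega>. sphere (P \<omega>) (dist (Q \<omega>) (R \<omega>)))"
  unfolding drawable_def
proof (rule attainable_step)
  show "attainable (\<lambda>xs. has_point xs P \<and> has_point xs Q \<and> has_point xs R)"
    using assms(1-3) attainable_conj persistent_has_point by (simp add: constructible_def)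
next
  fix xs assume v: "valid xs" and "has_point xs P \<and> has_point xs Q \<and> has_point xs R"
  then obtain i j k where i: "i < n + intersections xs" "\<And>\<omega>. \<omega> \<in> inputs \<Longrightarrow> fst (final xs \<omega>) ! i = P \<omega>"
    and j: "j < n + intersections xs" "\<And>\<omega>. \<omega> \<in> inputs \<Longrightarrow> fst (final xs \<omega>) ! j = Q \<omega>"
    and k: "k < n + intersections xs" "\<And>\<omega>. \<omega> \<in> inputs \<Longrightarrow> fst (final xs \<omega>) ! k = R \<omega>"
    unfolding has_point_def by blast
  have "exec (Draw_Circle i j k) (final xs \<omega>)
      = Some (fst (final xs \<omega>), snd (final xs \<omega>) @ [sphere (P \<omega>) (dist (Q \<omega>) (R \<omega>))])" if "\<omega> \<in> inputs" for \<omega>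
    using i j k length_final[OF v that] that assms(4)[OF that] by (cases "final xs \<omega>") force
  then show "\<exists>ys. valid (xs @ ys) \<and> has_curve (xs @ ys) (\<lambda>\<omega>. sphere (P \<omega>) (dist (Q \<omega>) (R \<omega>)))"
    using has_new_curve[OF v] by (intro exI[of _ "[Draw_Circle i j k]"]) (simp add: drawings_def)
qed

lemma holds_map_rule: "holds v (map_rule f r) \<longleftrightarrow> holds (\<lambda>p. v (f p)) r"
  by (induction r) auto

lemma finite_refs: "finite (refs r)"
  by (induction r) auto

text \<open>
  Rules used below are written with functions of the input in place of positions; \<open>None\<close> stands for
  the candidate, since the position it will occupy depends on the program.
\<close>

definition pick :: "point list \<Rightarrow> point \<Rightarrow> (point list \<Rightarrow> point) option \<Rightarrow> point" where
  "pick \<omega> X p = (case p of None \<Rightarrow> X | Some P \<Rightarrow> P \<omega>)"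

lemma pick_simps [simp]: "pick \<omega> X None = X" "pick \<omega> X (Some P) = P \<omega>"
  by (simp_all add: pick_def)

text \<open>
  The interface to intersection steps: all later constructions are obtained from it without
  mentioning positions. The hypothesis on \<open>X\<close> says that the rule singles out the point \<open>X \<omega>\<close> for
  every input, which is what the step requires.
\<close>

lemma constructible_intersection:
  assumes S: "drawable S" and T: "drawable T" and r: "\<And>P. Some P \<in> refs r \<Longrightarrow> constructible P"
    and ne: "\<And>\<omega>. \<omega> \<in> inputs \<Longrightarrow> S \<omega> \<noteq> T \<omega>"
    and X: "\<And>\<omega> Y. \<omega> \<in> inputs \<Longrightarrow> (Y \<in> S \<omega> \<and> Y \<in> T \<omega> \<and> holds (pick \<omega> Y) r) \<longleftrightarrow> Y = X \<omega>"
  shows "constructible X"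
  unfolding constructible_def
proof (rule attainable_step)
  let ?A = "{P. Some P \<in> refs r}"
  have "finite ?A"
    using finite_vimageI[OF finite_refs, of Some r] by (simp add: vimage_def inj_on_def)
  then have "attainable (\<lambda>xs. \<forall>P\<in>?A. has_point xs P)"
    using r by (intro attainable_Ball persistent_has_point) (auto simp: constructible_def)
  then show "attainable (\<lambda>xs. has_curve xs S \<and> has_curve xs T \<and> (\<forall>P\<in>?A. has_point xs P))"
    using S T by (intro attainable_conj persistent_has_curve) (auto simp: drawable_def)
next
  fix xs assume v: "valid xs"
    and G: "has_curve xs S \<and> has_curve xs T \<and> (\<forall>P\<in>{P. Some P \<in> refs r}. has_point xs P)"
  let ?N = "n + intersections xs"
  obtain a b where a: "a < drawings xs" "\<And>\<omega>. \<omega> \<in> inputs \<Longrightarrow> snd (final xs \<omega>) ! a = S \<omega>"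
    and b: "b < drawings xs" "\<And>\<omega>. \<omega> \<in> inputs \<Longrightarrow> snd (final xs \<omega>) ! b = T \<omega>"
    using G unfolding has_curve_def by blast
  have "\<forall>P. \<exists>i. Some P \<in> refs r \<longrightarrow> i < ?N \<and> (\<forall>\<omega>\<in>inputs. fst (final xs \<omega>) ! i = P \<omega>)"
    using G unfolding has_point_def by blast
  then obtain f where f: "\<And>P. Some P \<in> refs r \<Longrightarrow> f P < ?N"
    "\<And>P \<omega>. Some P \<in> refs r \<Longrightarrow> \<omega> \<in> inputs \<Longrightarrow> fst (final xs \<omega>) ! f P = P \<omega>"
    by metis
  \<comment> \<open>The candidate will be the next point and so gets the first free position.\<close>
  define g where "g p = (case p of None \<Rightarrow> ?N | Some P \<Rightarrow> f P)" for p
  let ?r = "map_rule g r"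
  have refs_le: "refs ?r \<subseteq> {..?N}"
  proof -
    have "g p \<le> ?N" if "p \<in> refs r" for p
      using f(1) that by (cases p) (auto simp: g_def less_imp_le)
    then show ?thesis
      by (auto simp: rule.set_map)
  qed
  have "exec (Intersect a b ?r) (final xs \<omega>) = Some (fst (final xs \<omega>) @ [X \<omega>], snd (final xs \<omega>))"
    if \<omega>: "\<omega> \<in> inputs" for \<omega>
  proof -
    obtain ps cs where fin: "final xs \<omega> = (ps, cs)"
      by force
    note len = length_final[OF v \<omega>, unfolded fin fst_conv snd_conv]
    have "holds (\<lambda>i. (ps @ [Y]) ! i) ?r \<longleftrightarrow> holds (pick \<omega> Y) r" for Y
      unfolding holds_map_rule
    proof (rule holds_cong)
      fix p assume p: "p \<in> refs r"
      show "(ps @ [Y]) ! g p = pick \<omega> Y p"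
      proof (cases p)
        case None
        then show ?thesis
          using len(1) by (simp add: g_def nth_append)
      next
        case (Some P)
        then show ?thesis
          using f(1)[of P] f(2)[of P, OF _ \<omega>] p fin len(1) by (simp add: g_def nth_append)
      qed
    qed
    then have sel: "selected (ps, cs) a b ?r = (\<lambda>Y. Y = X \<omega>)"
      using X[OF \<omega>] a(2)[OF \<omega>] b(2)[OF \<omega>] by (auto simp: selected_def fin fun_eq_iff)
    show ?thesis
      using a(1) b(1) a(2)[OF \<omega>] b(2)[OF \<omega>] ne[OF \<omega>] len refs_le by (simp add: fin sel)
  qed
  note * = run_snoc[OF v, of "Intersect a b ?r" "\<lambda>\<omega>. (fst (final xs \<omega>) @ [X \<omega>], snd (final xs \<omega>))", OF this]
  have "fst (final (xs @ [Intersect a b ?r]) \<omega>) ! ?N = X \<omega>" if "\<omega> \<in> inputs" for \<omega>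
    using *(2)[OF _ that] length_final(1)[OF v that] by (simp add: nth_append)
  then have "has_point (xs @ [Intersect a b ?r]) X"
    unfolding has_point_def intersections_append by (intro exI[of _ ?N]) (simp add: intersections_def)
  then show "\<exists>ys. valid (xs @ ys) \<and> has_point (xs @ ys) X"
    using *(1) by blast
qed

end


section \<open>Arithmetic of lengths by straightedge and compass\<close>

text \<open>
  From here on the plane carries coordinates in which the first segment joins \<open>0\<close> to \<open>1\<close>.
\<close>

lemma real_axis_hull: "affine hull {0, 1 :: complex} = {z. Im z = 0}"
  by (simp add: line_equation)

lemma real_ray: "ray 0 1 = {z. Im z = 0 \<and> 0 \<le> Re z}"
  by (auto simp: ray_def complex_eq_iff)

lemma equilateral_apex_iff:
  "cmod w = 1 \<and> cmod (w - 1) = 1 \<longleftrightarrow> Re w = 1 / 2 \<and> (Im w = sqrt 3 / 2 \<or> Im w = - sqrt 3 / 2)"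
proof -
  have "cmod w = 1 \<and> cmod (w - 1) = 1 \<longleftrightarrow> (Re w)\<^sup>2 + (Im w)\<^sup>2 = 1 \<and> (Re w - 1)\<^sup>2 + (Im w)\<^sup>2 = 1"
    by (simp add: cmod_def)
  also have "\<dots> \<longleftrightarrow> Re w = 1 / 2 \<and> (Im w)\<^sup>2 = (sqrt 3 / 2)\<^sup>2"
  proof (cases "Re w = 1 / 2")
    case True
    show ?thesis
      unfolding True by (auto simp: power_divide)
  next
    case False
    have "(Re w - 1)\<^sup>2 = (Re w)\<^sup>2 - 2 * Re w + 1"
      by (simp add: power2_eq_square algebra_simps)
    then show ?thesis
      using False by linarith
  qed
  finally show ?thesis
    by (simp add: power2_eq_iff)
qed

lemma similarity_basis: "similarity P (Q - P) 0 = P" "similarity P (Q - P) 1 = Q"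
  by (simp_all add: similarity_def)

text \<open>
  The perpendicular bisector of \<open>P Q\<close> meets the real axis in one point unless it is parallel to that
  axis.
\<close>

lemma equidistant_real_iff:
  assumes "Re P \<noteq> Re Q"
  shows "dist (of_real w) P = dist (of_real w) Q \<longleftrightarrow> w = ((cmod Q)\<^sup>2 - (cmod P)\<^sup>2) / (2 * (Re Q - Re P))"
proof -
  have "dist (of_real w) P = dist (of_real w) Q
      \<longleftrightarrow> (w - Re P)\<^sup>2 + (Im P)\<^sup>2 = (w - Re Q)\<^sup>2 + (Im Q)\<^sup>2"
    by (simp add: dist_norm cmod_def)
  also have "\<dots> \<longleftrightarrow> w * (2 * (Re Q - Re P)) = (cmod Q)\<^sup>2 - (cmod P)\<^sup>2"
    unfolding cmod_power2 by (auto simp: power2_eq_square algebra_simps)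
  finally show ?thesis
    using assms by (simp add: field_simps)
qed

context construction_problem
begin

text \<open>
  The line through the two intersection points of the circles about \<open>P\<close> and \<open>Q\<close> with radius
  \<open>P Q\<close>. A similarity taking \<open>0\<close> to \<open>P\<close> and \<open>1\<close> to \<open>Q\<close> turns these points into
  \<open>1 / 2 \<plusminus> (sqrt 3 / 2) \<i>\<close>, and the side of \<open>P Q\<close> distinguishes them.
\<close>

lemma drawable_bisector:
  assumes P: "constructible P" and Q: "constructible Q" and ne: "\<And>\<omega>. \<omega> \<in> inputs \<Longrightarrow> P \<omega> \<noteq> Q \<omega>"
  shows "drawable (\<lambda>\<omega>. {z. dist z (P \<omega>) = dist z (Q \<omega>)})"
proof -
  let ?f = "\<lambda>\<omega>. similarity (P \<omega>) (Q \<omega> - P \<omega>)"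
  let ?r = "\<lambda>\<omega>. dist (P \<omega>) (Q \<omega>)"
  \<comment> \<open>In the frame of the similarity the two intersection points are \<open>apex 1\<close> and \<open>apex (-1)\<close>.\<close>
  define apex where "apex s = Complex (1 / 2) (s * (sqrt 3 / 2))" for s
  have circles: "drawable (\<lambda>\<omega>. sphere (P \<omega>) (?r \<omega>))" "drawable (\<lambda>\<omega>. sphere (Q \<omega>) (?r \<omega>))"
    by (intro drawable_circle P Q ne; assumption)+
  have distinct: "sphere (P \<omega>) (?r \<omega>) \<noteq> sphere (Q \<omega>) (?r \<omega>)" if "\<omega> \<in> inputs" for \<omega>
  proof
    assume "sphere (P \<omega>) (?r \<omega>) = sphere (Q \<omega>) (?r \<omega>)"
    then have "Q \<omega> \<in> sphere (Q \<omega>) (?r \<omega>)"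
      by (metis mem_sphere)
    then show False
      using ne[OF that] by simp
  qed
  have both: "Y \<in> sphere (P \<omega>) (?r \<omega>) \<and> Y \<in> sphere (Q \<omega>) (?r \<omega>) \<longleftrightarrow> Y = ?f \<omega> (apex 1) \<or> Y = ?f \<omega> (apex (-1))"
    and left: "left_of (P \<omega>) (Q \<omega>) (?f \<omega> w) \<longleftrightarrow> 0 < Im w" if "\<omega> \<in> inputs" for \<omega> Y w
  proof -
    have q: "Q \<omega> - P \<omega> \<noteq> 0"
      using ne[OF that] by simp
    have d: "dist (P \<omega>) (?f \<omega> w) = ?r \<omega> * cmod w" "dist (Q \<omega>) (?f \<omega> w) = ?r \<omega> * cmod (w - 1)" for w
      using dist_similarity[of "P \<omega>" "Q \<omega> - P \<omega>" 0 w] dist_similarity[of "P \<omega>" "Q \<omega> - P \<omega>" 1 w]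
      by (simp_all add: similarity_basis dist_norm norm_minus_commute)
    obtain w where w: "Y = ?f \<omega> w"
      using surjD[OF surj_similarity[OF q]] by metis
    have "Y \<in> sphere (P \<omega>) (?r \<omega>) \<and> Y \<in> sphere (Q \<omega>) (?r \<omega>) \<longleftrightarrow> cmod w = 1 \<and> cmod (w - 1) = 1"
      using q by (simp add: w d)
    also have "\<dots> \<longleftrightarrow> w = apex 1 \<or> w = apex (-1)"
      unfolding equilateral_apex_iff by (auto simp: apex_def complex_eq_iff)
    finally show "Y \<in> sphere (P \<omega>) (?r \<omega>) \<and> Y \<in> sphere (Q \<omega>) (?r \<omega>) \<longleftrightarrow> Y = ?f \<omega> (apex 1) \<or> Y = ?f \<omega> (apex (-1))"
      using q by (simp add: w similarity_eq_iff)
    show "left_of (P \<omega>) (Q \<omega>) (?f \<omega> w) \<longleftrightarrow> 0 < Im w" for w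
      using left_of_similarity[OF q, of "P \<omega>" 0 1 w] by (simp add: similarity_basis left_of_def)
  qed
  have upper: "left_of (P \<omega>) (Q \<omega>) (?f \<omega> (apex 1))"
    and lower: "\<not> left_of (P \<omega>) (Q \<omega>) (?f \<omega> (apex (-1)))" if "\<omega> \<in> inputs" for \<omega>
    unfolding left[OF that] by (simp_all add: apex_def)
  have "constructible (\<lambda>\<omega>. ?f \<omega> (apex 1))"
  proof (rule constructible_intersection[OF circles _ distinct])
    show "constructible R" if "Some R \<in> refs (Left_Of (Some P) (Some Q) None)" for R
      using that P Q by auto
    show "(Y \<in> sphere (P \<omega>) (?r \<omega>) \<and> Y \<in> sphere (Q \<omega>) (?r \<omega>)
        \<and> holds (pick \<omega> Y) (Left_Of (Some P) (Some Q) None)) \<longleftrightarrow> Y = ?f \<omega> (apex 1)"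
      if "\<omega> \<in> inputs" for \<omega> Y
      unfolding holds.simps pick_simps using both[OF that, of Y] upper[OF that] lower[OF that] by metis
  qed
  moreover have "constructible (\<lambda>\<omega>. ?f \<omega> (apex (-1)))"
  proof (rule constructible_intersection[OF circles _ distinct])
    show "constructible R" if "Some R \<in> refs (Neg (Left_Of (Some P) (Some Q) None))" for R
      using that P Q by auto
    show "(Y \<in> sphere (P \<omega>) (?r \<omega>) \<and> Y \<in> sphere (Q \<omega>) (?r \<omega>)
        \<and> holds (pick \<omega> Y) (Neg (Left_Of (Some P) (Some Q) None))) \<longleftrightarrow> Y = ?f \<omega> (apex (-1))"
      if "\<omega> \<in> inputs" for \<omega> Y
      unfolding holds.simps pick_simps using both[OF that, of Y] upper[OF that] lower[OF that] by metis
  qed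
  moreover have "?f \<omega> (apex 1) \<noteq> ?f \<omega> (apex (-1))" if "\<omega> \<in> inputs" for \<omega>
    using ne[OF that] by (simp add: similarity_eq_iff apex_def)
  ultimately have "drawable (\<lambda>\<omega>. affine hull {?f \<omega> (apex 1), ?f \<omega> (apex (-1))})"
    by (rule drawable_line)
  then show ?thesis
  proof (rule drawable_cong)
    fix \<omega> assume "\<omega> \<in> inputs"
    then have q: "Q \<omega> - P \<omega> \<noteq> 0"
      using ne[of \<omega>] by simp
    have "affine hull {apex 1, apex (-1)} = {w. Re w = 1 / 2}"
      by (subst line_equation) (auto simp: apex_def complex_eq_iff)
    then have hull: "affine hull {?f \<omega> (apex 1), ?f \<omega> (apex (-1))} = ?f \<omega> ` {w. Re w = 1 / 2}"
      by (simp add: hull_similarity)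
    have "?f \<omega> w \<in> ?f \<omega> ` {w. Re w = 1 / 2} \<longleftrightarrow> ?f \<omega> w \<in> {z. dist z (P \<omega>) = dist z (Q \<omega>)}" for w
    proof -
      have "cmod w = cmod (w - 1) \<longleftrightarrow> Re w = 1 / 2"
        by (auto simp: cmod_def power2_eq_square algebra_simps)
      moreover have "dist (?f \<omega> w) (P \<omega>) = ?r \<omega> * cmod w" "dist (?f \<omega> w) (Q \<omega>) = ?r \<omega> * cmod (w - 1)"
        using dist_similarity[of "P \<omega>" "Q \<omega> - P \<omega>" w 0] dist_similarity[of "P \<omega>" "Q \<omega> - P \<omega>" w 1]
        by (simp_all add: similarity_basis dist_norm norm_minus_commute)
      ultimately show ?thesis
        using q by (simp add: inj_image_mem_iff[OF inj_similarity])
    qed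
    note same_members = this
    show "affine hull {?f \<omega> (apex 1), ?f \<omega> (apex (-1))} = {z. dist z (P \<omega>) = dist z (Q \<omega>)}"
      unfolding hull
    proof (rule set_eqI)
      fix z
      obtain w where "z = ?f \<omega> w"
        using surjD[OF surj_similarity[OF q]] by blast
      then show "z \<in> ?f \<omega> ` {w. Re w = 1 / 2} \<longleftrightarrow> z \<in> {z. dist z (P \<omega>) = dist z (Q \<omega>)}"
        using same_members by simp
    qed
  qed
qed

end

text \<open>
  The segment from \<open>0\<close> to \<open>1\<close> serves as unit. A length is constructible if the corresponding point
  of the positive real axis is.
\<close>

locale normalized_problem = construction_problem +
  assumes n_ge_2: "2 \<le> n" and origin: "\<omega> \<in> inputs \<Longrightarrow> \<omega> ! 0 = 0" and unit: "\<omega> \<in> inputs \<Longrightarrow> \<omega> ! 1 = 1"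
begin

lemma constructible_0: "constructible (\<lambda>_. 0)"
  and constructible_1: "constructible (\<lambda>_. 1)"
  by (rule constructible_cong[OF constructible_input[of 0]], use n_ge_2 origin in auto)
    (rule constructible_cong[OF constructible_input[of 1]], use n_ge_2 unit in auto)

lemma drawable_real_axis: "drawable (\<lambda>_. {z. Im z = 0})"
  using drawable_line[OF constructible_0 constructible_1] by (simp add: real_axis_hull)

text \<open>
  Carry the distance over to the real axis by a circle about the origin.
\<close>

lemma constructible_dist:
  assumes "constructible P" "constructible Q" "\<And>\<omega>. \<omega> \<in> inputs \<Longrightarrow> P \<omega> \<noteq> Q \<omega>"
  shows "constructible (\<lambda>\<omega>. of_real (dist (P \<omega>) (Q \<omega>)))"
proof (rule constructible_intersection[OF drawable_real_axis drawable_circle[OF constructible_0 assms]])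
  let ?r = "On_Ray (Some (\<lambda>_. 0)) (Some (\<lambda>_. 1)) None"
  show "constructible R" if "Some R \<in> refs ?r" for R
    using that constructible_0 constructible_1 by auto
  show "{z. Im z = 0} \<noteq> sphere 0 (dist (P \<omega>) (Q \<omega>))" if "\<omega> \<in> inputs" for \<omega>
    using assms(3)[OF that] by (auto simp: set_eq_iff intro!: exI[of _ 0])
  show "(Y \<in> {z. Im z = 0} \<and> Y \<in> sphere 0 (dist (P \<omega>) (Q \<omega>)) \<and> holds (pick \<omega> Y) ?r)
      \<longleftrightarrow> Y = of_real (dist (P \<omega>) (Q \<omega>))" for \<omega> Y
    by (auto simp: real_ray complex_eq_iff cmod_eq_Re)
qed

text \<open>
  The circle about \<open>c\<close> through \<open>p\<close> meets the real axis again in the mirror image of \<open>p\<close>.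
\<close>

lemma constructible_real_reflection:
  assumes c: "constructible (\<lambda>\<omega>. of_real (c \<omega>))" and p: "constructible (\<lambda>\<omega>. of_real (p \<omega>))"
    and ne: "\<And>\<omega>. \<omega> \<in> inputs \<Longrightarrow> c \<omega> \<noteq> p \<omega>"
  shows "constructible (\<lambda>\<omega>. of_real (2 * c \<omega> - p \<omega>))"
proof (rule constructible_intersection[OF drawable_real_axis drawable_circle[OF c c p]])
  let ?r = "Neg (Same_Point None (Some (\<lambda>\<omega>. of_real (p \<omega>))))"
  show "constructible R" if "Some R \<in> refs ?r" for R
    using that p by auto
  show "complex_of_real (c \<omega>) \<noteq> complex_of_real (p \<omega>)" if "\<omega> \<in> inputs" for \<omega>
    using ne[OF that] by simp
  show "{z. Im z = 0} \<noteq> sphere (of_real (c \<omega>)) (dist (of_real (c \<omega>)) (complex_of_real (p \<omega>)))"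
    if "\<omega> \<in> inputs" for \<omega>
    using ne[OF that] by (auto simp: set_eq_iff intro!: exI[of _ "of_real (c \<omega>)"])
  show "(Y \<in> {z. Im z = 0} \<and> Y \<in> sphere (of_real (c \<omega>)) (dist (of_real (c \<omega>)) (complex_of_real (p \<omega>)))
      \<and> holds (pick \<omega> Y) ?r) \<longleftrightarrow> Y = of_real (2 * c \<omega> - p \<omega>)" if "\<omega> \<in> inputs" for \<omega> Y
  proof (cases "Im Y = 0")
    case True
    then obtain y where y: "Y = of_real y"
      by (metis complex_eq_iff Re_complex_of_real Im_complex_of_real)
    have "\<bar>c \<omega> - y\<bar> = \<bar>c \<omega> - p \<omega>\<bar> \<and> y \<noteq> p \<omega> \<longleftrightarrow> y = 2 * c \<omega> - p \<omega>"
      using ne[OF that] by auto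
    then show ?thesis
      by (simp add: y dist_of_real dist_real_def del: of_real_diff of_real_mult)
  qed (auto simp: complex_eq_iff)
qed

lemma constructible_real_equidistant:
  assumes P: "constructible P" and Q: "constructible Q"
    and ne: "\<And>\<omega>. \<omega> \<in> inputs \<Longrightarrow> Re (P \<omega>) \<noteq> Re (Q \<omega>)"
  shows "constructible (\<lambda>\<omega>. of_real (((cmod (Q \<omega>))\<^sup>2 - (cmod (P \<omega>))\<^sup>2) / (2 * (Re (Q \<omega>) - Re (P \<omega>)))))"
    (is "constructible (\<lambda>\<omega>. of_real (?c \<omega>))")
proof (rule constructible_intersection[OF drawable_real_axis drawable_bisector[OF P Q], of Unrestricted])
  fix \<omega> assume \<omega>: "\<omega> \<in> inputs"
  note eq = equidistant_real_iff[OF ne[OF \<omega>]]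
  show "P \<omega> \<noteq> Q \<omega>"
    using ne[OF \<omega>] by auto
  \<comment> \<open>The bisector differs from the real axis, since it misses another point of it.\<close>
  have "of_real (?c \<omega> + 1) \<notin> {z. dist z (P \<omega>) = dist z (Q \<omega>)}"
    using eq[of "?c \<omega> + 1"] by simp
  then show "{z. Im z = 0} \<noteq> {z. dist z (P \<omega>) = dist z (Q \<omega>)}"
    by (metis (mono_tags, lifting) Im_complex_of_real mem_Collect_eq)
  show "(Y \<in> {z. Im z = 0} \<and> Y \<in> {z. dist z (P \<omega>) = dist z (Q \<omega>)} \<and> holds (pick \<omega> Y) Unrestricted)
      \<longleftrightarrow> Y = of_real (?c \<omega>)" for Y
  proof (cases "Im Y = 0")
    case True
    then obtain y where y: "Y = of_real y"
      by (metis complex_eq_iff Re_complex_of_real Im_complex_of_real)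
    show ?thesis
      using eq[of y] by (simp add: y del: of_real_divide of_real_diff of_real_mult)
  qed (auto simp: complex_eq_iff)
qed auto

lemma constructible_uminus:
  assumes "constructible (\<lambda>\<omega>. of_real (x \<omega>))" "\<And>\<omega>. \<omega> \<in> inputs \<Longrightarrow> 0 < x \<omega>"
  shows "constructible (\<lambda>\<omega>. of_real (- x \<omega>))"
proof -
  have "constructible (\<lambda>\<omega>. of_real (2 * 0 - x \<omega>))"
    by (rule constructible_real_reflection[OF _ assms(1)]) (use constructible_0 assms(2) in force)+
  then show ?thesis
    by simp
qed

text \<open>
  The sum is the distance from \<open>x\<close> to \<open>- y\<close>.
\<close>

lemma constructible_add:
  assumes x: "constructible (\<lambda>\<omega>. of_real (x \<omega>))" "\<And>\<omega>. \<omega> \<in> inputs \<Longrightarrow> 0 < x \<omega>"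
    and y: "constructible (\<lambda>\<omega>. of_real (y \<omega>))" "\<And>\<omega>. \<omega> \<in> inputs \<Longrightarrow> 0 < y \<omega>"
  shows "constructible (\<lambda>\<omega>. of_real (x \<omega> + y \<omega>))"
proof -
  have pos: "0 < x \<omega> + y \<omega>" if "\<omega> \<in> inputs" for \<omega>
    using x(2)[OF that] y(2)[OF that] by simp
  have ne: "complex_of_real (x \<omega>) \<noteq> of_real (- y \<omega>)" if "\<omega> \<in> inputs" for \<omega>
    unfolding of_real_eq_iff using pos[OF that] by simp
  show ?thesis
  proof (rule constructible_cong[OF constructible_dist[OF x(1) constructible_uminus[OF y] ne]])
    fix \<omega> assume "\<omega> \<in> inputs"
    from pos[OF this] show "complex_of_real (dist (complex_of_real (x \<omega>)) (complex_of_real (- y \<omega>))) = of_real (x \<omega> + y \<omega>)"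
      unfolding dist_of_real dist_real_def by (simp del: of_real_add)
  qed
qed

lemma drawable_imaginary_axis: "drawable (\<lambda>_. {z. Re z = 0})"
proof -
  have "drawable (\<lambda>_. {z. dist z (of_real (- 1)) = dist z (1::complex)})"
    by (rule drawable_bisector) (use constructible_uminus[of "\<lambda>_. 1"] constructible_1 in auto)
  moreover have "{z. dist z (of_real (- 1)) = dist z (1::complex)} = {z. Re z = 0}"
    by (auto simp: dist_norm cmod_def power2_eq_square algebra_simps)
  ultimately show ?thesis
    by simp
qed

text \<open>
  Of two opposite points on the imaginary axis, the one to the left of the unit segment is taken.
\<close>

lemma constructible_imaginary:
  assumes S: "drawable S" and x: "\<And>\<omega>. \<omega> \<in> inputs \<Longrightarrow> 0 < x \<omega>"
    and eq: "\<And>\<omega> t. \<omega> \<in> inputs \<Longrightarrow> Complex 0 t \<in> S \<omega> \<longleftrightarrow> t = x \<omega> \<or> t = - x \<omega>"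
  shows "constructible (\<lambda>\<omega>. Complex 0 (x \<omega>))"
proof (rule constructible_intersection[OF drawable_imaginary_axis S])
  let ?r = "Left_Of (Some (\<lambda>_. 0)) (Some (\<lambda>_. 1)) None"
  show "constructible R" if "Some R \<in> refs ?r" for R
    using that constructible_0 constructible_1 by auto
  fix \<omega> assume \<omega>: "\<omega> \<in> inputs"
  have "Complex 0 0 \<notin> S \<omega>"
    using eq[OF \<omega>, of 0] x[OF \<omega>] by simp
  then show "{z. Re z = 0} \<noteq> S \<omega>"
    by (metis (mono_tags, lifting) complex.sel(1) mem_Collect_eq)
  show "(Y \<in> {z. Re z = 0} \<and> Y \<in> S \<omega> \<and> holds (pick \<omega> Y) ?r) \<longleftrightarrow> Y = Complex 0 (x \<omega>)" for Y
  proof (cases "Re Y = 0")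
    case True
    then obtain t where t: "Y = Complex 0 t"
      by (metis complex.exhaust_sel)
    show ?thesis
      using eq[OF \<omega>, of t] x[OF \<omega>] by (auto simp: t left_of_def)
  qed (auto simp: complex_eq_iff)
qed

text \<open>
  The circle centred on the real axis through \<open>- y\<close> and \<open>x \<i>\<close> meets the real axis again in
  \<open>x\<^sup>2 / y\<close>, because in a right triangle the altitude \<open>x\<close> is the mean proportional of the two
  parts of the hypotenuse. Its centre is the intersection of the real axis with a perpendicular
  bisector. The cases \<open>y = 1\<close> and \<open>x = 1\<close> give squares and reciprocals.
\<close>

lemma constructible_third_proportional:
  assumes x: "constructible (\<lambda>\<omega>. of_real (x \<omega>))" "\<And>\<omega>. \<omega> \<in> inputs \<Longrightarrow> 0 < x \<omega>"
    and y: "constructible (\<lambda>\<omega>. of_real (y \<omega>))" "\<And>\<omega>. \<omega> \<in> inputs \<Longrightarrow> 0 < y \<omega>"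
  shows "constructible (\<lambda>\<omega>. of_real ((x \<omega>)\<^sup>2 / y \<omega>))"
proof -
  have "drawable (\<lambda>\<omega>. sphere 0 (dist 0 (complex_of_real (x \<omega>))))"
    by (rule drawable_circle[OF constructible_0 constructible_0 x(1)]) (use x(2) in force)
  then have ix: "constructible (\<lambda>\<omega>. Complex 0 (x \<omega>))"
    by (rule constructible_imaginary[OF _ x(2)]) (use x(2) in \<open>force simp: cmod_def\<close>)+
  have ny: "constructible (\<lambda>\<omega>. of_real (- y \<omega>))"
    by (rule constructible_uminus[OF y])
  \<comment> \<open>The point of the real axis that is equidistant from \<open>- y\<close> and \<open>x \<i>\<close>.\<close>
  let ?c = "\<lambda>\<omega>. ((x \<omega>)\<^sup>2 - (y \<omega>)\<^sup>2) / (2 * y \<omega>)"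
  have "constructible (\<lambda>\<omega>. of_real (?c \<omega>))"
    by (rule constructible_cong[OF constructible_real_equidistant[OF ny ix]])
      (use y(2) in \<open>force simp: cmod_power2\<close>)+
  then have "constructible (\<lambda>\<omega>. of_real (2 * ?c \<omega> - - y \<omega>))"
  proof (rule constructible_real_reflection[OF _ ny])
    fix \<omega> assume \<omega>: "\<omega> \<in> inputs"
    have "?c \<omega> + y \<omega> = ((x \<omega>)\<^sup>2 + (y \<omega>)\<^sup>2) / (2 * y \<omega>)"
      using y(2)[OF \<omega>] by (simp add: field_simps power2_eq_square)
    moreover have "\<dots> > 0"
      using x(2)[OF \<omega>] y(2)[OF \<omega>] by (intro divide_pos_pos add_pos_pos) auto
    ultimately show "?c \<omega> \<noteq> - y \<omega>"
      by linarith
  qed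
  then show ?thesis
  proof (rule constructible_cong)
    fix \<omega> assume "\<omega> \<in> inputs"
    from y(2)[OF this] have "2 * ?c \<omega> - - y \<omega> = (x \<omega>)\<^sup>2 / y \<omega>"
      by (simp add: field_simps power2_eq_square)
    then show "complex_of_real (2 * ?c \<omega> - - y \<omega>) = of_real ((x \<omega>)\<^sup>2 / y \<omega>)"
      by (simp only:)
  qed
qed

text \<open>
  The same altitude theorem read backwards: the circle with diameter from \<open>- 1\<close> to \<open>x\<close> meets the
  imaginary axis at height \<open>sqrt x\<close>.
\<close>

lemma constructible_sqrt:
  assumes x: "constructible (\<lambda>\<omega>. of_real (x \<omega>))" "\<And>\<omega>. \<omega> \<in> inputs \<Longrightarrow> 0 < x \<omega>"
  shows "constructible (\<lambda>\<omega>. of_real (sqrt (x \<omega>)))"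
proof -
  have m1: "constructible (\<lambda>_. of_real (- 1))"
    using constructible_uminus[of "\<lambda>_. 1"] constructible_1 by simp
  \<comment> \<open>The midpoint of \<open>- 1\<close> and \<open>x\<close>.\<close>
  let ?c = "\<lambda>\<omega>. (x \<omega> - 1) / 2"
  have c: "constructible (\<lambda>\<omega>. of_real (?c \<omega>))"
  proof (rule constructible_cong[OF constructible_real_equidistant[OF m1 x(1)]])
    fix \<omega> assume \<omega>: "\<omega> \<in> inputs"
    then have pos: "x \<omega> + 1 > 0"
      using x(2)[OF \<omega>] by simp
    then show "Re (complex_of_real (- 1)) \<noteq> Re (complex_of_real (x \<omega>))"
      by simp
    have "((x \<omega>)\<^sup>2 - 1) / (2 * (x \<omega> + 1)) = ?c \<omega>"
      using pos by (simp add: field_simps power2_eq_square)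
    then show "complex_of_real (((cmod (complex_of_real (x \<omega>)))\<^sup>2 - (cmod (complex_of_real (- 1)))\<^sup>2)
        / (2 * (Re (complex_of_real (x \<omega>)) - Re (complex_of_real (- 1))))) = of_real (?c \<omega>)"
      by (simp add: cmod_power2 del: of_real_divide of_real_mult of_real_diff)
  qed
  have circle: "drawable (\<lambda>\<omega>. sphere (of_real (?c \<omega>)) (dist (complex_of_real (?c \<omega>)) (of_real (x \<omega>))))"
  proof (rule drawable_circle[OF c c x(1)])
    show "complex_of_real (?c \<omega>) \<noteq> of_real (x \<omega>)" if "\<omega> \<in> inputs" for \<omega>
      unfolding of_real_eq_iff using x(2)[OF that] by simp
  qed
  have "constructible (\<lambda>\<omega>. Complex 0 (sqrt (x \<omega>)))"
  proof (rule constructible_imaginary[OF circle])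
    fix \<omega> t assume \<omega>: "\<omega> \<in> inputs"
    have "Complex 0 t \<in> sphere (of_real (?c \<omega>)) (dist (complex_of_real (?c \<omega>)) (of_real (x \<omega>)))
        \<longleftrightarrow> (?c \<omega>)\<^sup>2 + t\<^sup>2 = (?c \<omega> - x \<omega>)\<^sup>2"
      by (simp add: dist_norm cmod_def real_sqrt_abs[symmetric] del: real_sqrt_abs)
    also have "\<dots> \<longleftrightarrow> t\<^sup>2 = (sqrt (x \<omega>))\<^sup>2"
      using x(2)[OF \<omega>] by (simp add: power2_eq_square field_simps)
    finally show "Complex 0 t \<in> sphere (of_real (?c \<omega>)) (dist (complex_of_real (?c \<omega>)) (of_real (x \<omega>)))
        \<longleftrightarrow> t = sqrt (x \<omega>) \<or> t = - sqrt (x \<omega>)"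
      by (simp only: power2_eq_iff)
  qed (use x(2) in auto)
  then have "constructible (\<lambda>\<omega>. of_real (dist 0 (Complex 0 (sqrt (x \<omega>)))))"
    by (rule constructible_dist[OF constructible_0]) (use x(2) in \<open>force simp: complex_eq_iff\<close>)
  then show ?thesis
    by (rule constructible_cong) (use x(2) in \<open>force simp: cmod_def\<close>)
qed

text \<open>
  Doubling the exponent \<open>k\<close> costs two squares and a square root:
  the \<open>2 * k\<close>-th root of \<open>x ^ (2 * k) + y ^ (2 * k)\<close> is the square root of the \<open>k\<close>-th root of
  \<open>(x\<^sup>2) ^ k + (y\<^sup>2) ^ k\<close>.
\<close>

lemma constructible_power_sum_root:
  assumes "constructible (\<lambda>\<omega>. of_real (x \<omega>))" "\<And>\<omega>. \<omega> \<in> inputs \<Longrightarrow> 0 < x \<omega>"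
    and "constructible (\<lambda>\<omega>. of_real (y \<omega>))" "\<And>\<omega>. \<omega> \<in> inputs \<Longrightarrow> 0 < y \<omega>"
  shows "constructible (\<lambda>\<omega>. of_real (root (2 ^ m) (x \<omega> ^ 2 ^ m + y \<omega> ^ 2 ^ m)))"
  using assms
proof (induction m arbitrary: x y)
  case 0
  then show ?case
    using constructible_add[of x y] by simp
next
  case (Suc m)
  have square: "constructible (\<lambda>\<omega>. of_real ((z \<omega>)\<^sup>2))"
    if "constructible (\<lambda>\<omega>. of_real (z \<omega>))" "\<And>\<omega>. \<omega> \<in> inputs \<Longrightarrow> 0 < z \<omega>" for z
    using constructible_third_proportional[of z "\<lambda>_. 1"] that constructible_1 by simp
  have "constructible (\<lambda>\<omega>. of_real (root (2 ^ m) (((x \<omega>)\<^sup>2) ^ 2 ^ m + ((y \<omega>)\<^sup>2) ^ 2 ^ m)))"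
    by (rule Suc.IH) (use square Suc.prems in \<open>force+\<close>)
  then have "constructible (\<lambda>\<omega>. of_real (sqrt (root (2 ^ m) (((x \<omega>)\<^sup>2) ^ 2 ^ m + ((y \<omega>)\<^sup>2) ^ 2 ^ m))))"
  proof (rule constructible_sqrt)
    fix \<omega> assume "\<omega> \<in> inputs"
    from Suc.prems(2)[OF this] Suc.prems(4)[OF this] show "0 < root (2 ^ m) (((x \<omega>)\<^sup>2) ^ 2 ^ m + ((y \<omega>)\<^sup>2) ^ 2 ^ m)"
      by (simp add: add_pos_pos)
  qed
  then show ?case
    by (simp add: sqrt_def real_root_mult_exp[symmetric] power_mult[symmetric] mult.commute)
qed

end

interpretation two_segments: normalized_problem "{[0, 1, C, D] | C D. C \<noteq> D}" 4
  by unfold_locales auto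

text \<open>
  In units of the first segment let \<open>t\<close> be the length of the second one. The length sought is the
  reciprocal of \<open>h\<close>, the \<open>k\<close>-th root of \<open>1 + (1 / t) ^ k\<close>. The construction found for
  \<open>A = 0\<close> and \<open>B = 1\<close> is then transported by the similarity that takes \<open>0\<close> to \<open>A\<close> and \<open>1\<close> to \<open>B\<close>.
\<close>

lemma constructible_if_power_of_two:
  "\<exists>xs i j. \<forall>A B C D. A \<noteq> B \<longrightarrow> C \<noteq> D \<longrightarrow>
     (\<exists>c. produces xs i j A B C D c
        \<and> 1 / c ^ 2 ^ m = 1 / dist A B ^ 2 ^ m + 1 / dist C D ^ 2 ^ m)"
proof -
  let ?t = "\<lambda>\<omega> :: point list. dist (\<omega> ! 2) (\<omega> ! 3)"
  let ?h = "\<lambda>\<omega>. root (2 ^ m) (1 ^ 2 ^ m + (1 / ?t \<omega>) ^ 2 ^ m)"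
  let ?I = "{[0, 1, C, D] | C D :: point. C \<noteq> D}"
  have t: "two_segments.constructible (\<lambda>\<omega>. of_real (?t \<omega>))"
    by (intro two_segments.constructible_dist two_segments.constructible_input) auto
  have t_pos: "0 < ?t \<omega>" if "\<omega> \<in> ?I" for \<omega>
    using that by auto
  have one: "two_segments.constructible (\<lambda>_. of_real 1)"
    using two_segments.constructible_1 by simp
  \<comment> \<open>Reciprocals are third proportionals of the unit; the square of 1 only matches their form.\<close>
  have "two_segments.constructible (\<lambda>\<omega>. of_real (1\<^sup>2 / ?t \<omega>))"
    by (rule two_segments.constructible_third_proportional[OF one _ t]) (use t_pos in auto)
  then have h: "two_segments.constructible (\<lambda>\<omega>. of_real (?h \<omega>))"
    by (intro two_segments.constructible_power_sum_root one) (use t_pos in auto)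
  have h_pos: "0 < ?h \<omega>" if "\<omega> \<in> ?I" for \<omega>
    using t_pos[OF that] by (simp add: add_pos_pos)
  have c: "two_segments.constructible (\<lambda>\<omega>. of_real (1\<^sup>2 / ?h \<omega>))"
    by (rule two_segments.constructible_third_proportional[OF one _ h]) (use h_pos in auto)
  have "two_segments.valid []"
    by (simp add: two_segments.valid_def)
  then obtain xs where v: "two_segments.valid xs"
    and "two_segments.has_point xs (\<lambda>\<omega>. of_real (1\<^sup>2 / ?h \<omega>))"
    using c unfolding two_segments.constructible_def two_segments.attainable_def by fastforce
  then obtain j where j: "j < 4 + intersections xs"
    "\<And>\<omega>. \<omega> \<in> ?I \<Longrightarrow> fst (two_segments.final xs \<omega>) ! j = of_real (1\<^sup>2 / ?h \<omega>)"
    unfolding two_segments.has_point_def by blast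
  have "\<exists>c. produces xs 0 j A B C D c \<and> 1 / c ^ 2 ^ m = 1 / dist A B ^ 2 ^ m + 1 / dist C D ^ 2 ^ m"
    if ne: "A \<noteq> B" "C \<noteq> D" for A B C D
  proof -
    let ?f = "similarity A (B - A)"
    have q: "B - A \<noteq> 0"
      using ne by simp
    obtain C' D' where C': "C = ?f C'" "D = ?f D'"
      using surjD[OF surj_similarity[OF q]] by metis
    let ?\<omega> = "[0, 1, C', D']"
    have \<omega>: "?\<omega> \<in> ?I"
      using ne(2) C' by auto
    obtain ps cs where ps: "run xs (?\<omega>, []) = Some (ps, cs)"
      using v \<omega> unfolding two_segments.valid_def by fastforce
    then have fin: "two_segments.final xs ?\<omega> = (ps, cs)"
      by (simp add: two_segments.final_def)
    obtain us where us: "ps = ?\<omega> @ us" "length us = intersections xs"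
      using run_extends[OF ps] by auto
    have nth: "ps ! 0 = 0" "ps ! j = of_real (1 / ?h ?\<omega>)" "0 < length ps" "j < length ps"
      using us j(1) j(2)[OF \<omega>] fin by auto
    have "run xs (map_state ?f (?\<omega>, [])) = Some (map_state ?f (ps, cs))"
      by (rule run_similarity[OF q ps])
    then have run: "run xs ([A, B, C, D], []) = Some (map ?f ps, map ((`) ?f) cs)"
      by (simp add: map_state_def similarity_basis C')
    let ?c = "dist A B * (1 / ?h ?\<omega>)"
    have c_pos: "0 < ?c"
      using h_pos[OF \<omega>] ne(1) by simp
    have "dist (map ?f ps ! 0) (map ?f ps ! j) = cmod (B - A) * dist (ps ! 0) (ps ! j)"
      using nth(3,4) by (simp only: nth_map dist_similarity)
    also have "\<dots> = ?c"
      unfolding nth(1,2) using h_pos[OF \<omega>]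
      by (simp add: dist_norm norm_minus_commute norm_divide del: of_real_divide)
    finally have "dist (map ?f ps ! 0) (map ?f ps ! j) = ?c" .
    then have "produces xs 0 j A B C D ?c"
      unfolding produces_def using run nth(3,4) c_pos
      by (intro exI[of _ "map ?f ps"] exI[of _ "map ((`) ?f) cs"]) (metis dist_self length_map less_irrefl)
    moreover have "1 / ?c ^ 2 ^ m = 1 / dist A B ^ 2 ^ m + 1 / dist C D ^ 2 ^ m"
    proof -
      have "(?h ?\<omega>) ^ 2 ^ m = 1 + 1 / dist C' D' ^ 2 ^ m"
        by (simp add: power_one_over)
      moreover have "dist C D = dist A B * dist C' D'"
        unfolding C' dist_similarity by (simp add: dist_norm norm_minus_commute)
      ultimately show ?thesis
        by (simp add: power_mult_distrib power_divide add_divide_distrib)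
    qed
    ultimately show ?thesis
      by blast
  qed
  then show ?thesis
    by blast
qed

lemma reciprocal_power_sum_iff:
  fixes a b c :: real
  assumes "0 < k" "0 < a" "0 < b" "0 < c"
  shows "1 / c ^ k = 1 / a ^ k + 1 / b ^ k \<longleftrightarrow> c = a * b / root k (a ^ k + b ^ k)"
proof -
  have pos: "0 < a ^ k" "0 < b ^ k" "0 < c ^ k"
    using assms by auto
  have "1 / z = 1 / x + 1 / y \<longleftrightarrow> z = x * y / (x + y)" if "0 < x" "0 < y" "0 < z" for x y z :: real
    using that by (auto simp: field_simps)
  from this[OF pos] have "1 / c ^ k = 1 / a ^ k + 1 / b ^ k \<longleftrightarrow> c ^ k = a ^ k * b ^ k / (a ^ k + b ^ k)" .
  also have "a ^ k * b ^ k / (a ^ k + b ^ k) = (a * b / root k (a ^ k + b ^ k)) ^ k"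
    using assms pos by (simp add: power_divide power_mult_distrib)
  also have "c ^ k = \<dots> \<longleftrightarrow> c = a * b / root k (a ^ k + b ^ k)"
    using assms pos by (intro power_eq_iff_eq_base) (auto simp: add_nonneg_nonneg)
  finally show ?thesis .
qed

theorem theorem1:
  fixes k :: nat
  assumes "0 < k"
  shows "(\<forall>a b c :: real. 0 < a \<longrightarrow> 0 < b \<longrightarrow> 0 < c \<longrightarrow>
            (1 / c ^ k = 1 / a ^ k + 1 / b ^ k \<longleftrightarrow> c = a * b / root k (a ^ k + b ^ k)))
       \<and> ((\<exists>xs i j. \<forall>A B C D. A \<noteq> B \<longrightarrow> C \<noteq> D \<longrightarrow>
              (\<exists>c. produces xs i j A B C D c
                 \<and> 1 / c ^ k = 1 / dist A B ^ k + 1 / dist C D ^ k))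
          \<longleftrightarrow> (\<exists>m. k = 2 ^ m))"
  using reciprocal_power_sum_iff[OF assms] power_of_two_if_constructible constructible_if_power_of_two
  by (intro conjI iffI; blast)

end
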